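(* Assume that there is $\epsilon>0$ such that for all $i,l$, $\tilde f_{i;\mathrm{res}}(x)=O(\kappa(x)^{-(1+\epsilon)})$ and $\frac{\partial\tilde f_{i;\mathrm{res}}}{\partial x_l}(x)=o(\kappa(x)^{-(1+\epsilon)})$ as $x$ approaches $\mathcal{E}$. Let $x_\ast\in\mathcal{E}$ be an equilibrium on the horizon for the desingularized vector field $g$ with $C_\ast:=G(x_\ast)>0$, which is mapped to a nonzero root $Y_0$ of the balance law $-\frac1k\Lambda_\alpha Y_0+f_{\alpha,k}(Y_0)=0$ through $Y_0=r_{x_\ast}^{\Lambda_\alpha}x_\ast$ and $x_\ast=r_{Y_0}^{-\Lambda_\alpha}Y_0$, where $r_{x_\ast}:=(kC_\ast)^{-1/k}$ and $r_{Y_0}:=p(Y_0)$ $(=r_{x_\ast})$. Let $A=-\frac1k\Lambda_\alpha+Df_{\alpha,k}(Y_0)$, $A_g=-C_\ast\Lambda_\alpha+D\tilde f(x_\ast)$ and $P_\ast=\Lambda_\alpha x_\ast\,\nabla p(x_\ast)^T$. (1) (From $A$ to $Dg(x_\ast)$.) When all the eigenpairs of $A$ are determined, all the eigenpairs of $Dg(x_\ast)$ are constructed through the following correspondence: - common eigenvalue: $1$ for $A$ corresponds to $-C_\ast$ for $Dg(x_\ast)$; - common eigenvector: $\Lambda_\alpha Y_0$ for $A$ corresponds to $\Lambda_\alpha r_{Y_0}^{-\Lambda_\alpha}Y_0$ for $Dg(x_\ast)$; - remaining eigenvalues: $\tilde\lambda$ for $A$ corresponds to $\lambda=r_{Y_0}^{-k}\tilde\lambda$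 for $Dg(x_\ast)$; - remaining (generalized) eigenvectors: $U$ for $A$ corresponds to $(I-P_\ast)r_{Y_0}^{-\Lambda_\alpha}U$ for $Dg(x_\ast)$. (2) (From $Dg(x_\ast)$ to $A$.) Similarly, if all the eigenpairs of $Dg(x_\ast)$ are determined, then all the eigenpairs of $A$ are constructed through the following correspondence: - common eigenvalue: $-C_\ast$ for $Dg(x_\ast)$ corresponds to $1$ for $A$; - common eigenvector: $\Lambda_\alpha x_\ast$ for $Dg(x_\ast)$ corresponds to $\Lambda_\alpha r_{x_\ast}^{\Lambda_\alpha}x_\ast$ for $A$; - remaining eigenvalues: $\lambda$ for $Dg(x_\ast)$ corresponds to $\tilde\lambda=r_{x_\ast}^{k}\lambda$ for $A$; - remaining (generalized) eigenvectors: $(I-P_\ast)u$ for $Dg(x_\ast)$ corresponds to $r_{x_\ast}^{\Lambda_\alpha}(A_g-kC_\ast I)u$ for $A$. (3) Moreover, the Jordan structure associated with (corresponding) eigenvalues, namely the number of Jordan blocks and their size, are identical except for $kC_\ast\in\mathrm{Spec}(Dg(x_\ast))$, if it exists, and $1\in\mathrm{Spec}(A)$.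
   Context: Let $\alpha=(\alpha_1,\ldots,\alpha_n)$ be nonnegative integers, not all zero, $k>0$ real, $\Lambda_\alpha=\mathrm{diag}(\alpha_1,\ldots,\alpha_n)$, and $s^{\Lambda_\alpha}=\mathrm{diag}(s^{\alpha_1},\ldots,s^{\alpha_n})$ for $s>0$. The map $f:\mathbb{R}^n\to\mathbb{R}^n$ is $C^r$ with $r\ge2$ and is asymptotically quasi-homogeneous of type $\alpha$ and order $k+1$ at infinity: there is a quasi-homogeneous vector field $f_{\alpha,k}$ of type $\alpha$ and order $k+1$, i.e. $f_{i;\alpha,k}(s^{\Lambda_\alpha}x)=s^{k+\alpha_i}f_{i;\alpha,k}(x)$ for all $x\in\mathbb{R}^n$, $s>0$, such that $f_i(s^{\Lambda_\alpha}x)-s^{k+\alpha_i}f_{i;\alpha,k}(x)=o(s^{k+\alpha_i})$ as $s\to+\infty$, uniformly for $x$ in the unit sphere. $f_{\alpha,k}$ is $C^1$. Put $f_{\mathrm{res}}=f-f_{\alpha,k}$. Quasi-parabolic compactification (applied only to the components with nonzero $\alpha_i$): let $J=\{i:\alpha_i>0\}$, let $c$ be the least common multiple of the $\alpha_i$, $i\in J$, $\beta_i=c/\alpha_i$ for $i\in J$, $p(x)=\big(\sum_{i\in J}x_i^{2\beta_i}\big)^{1/(2c)}$, $\mathcal{D}=\{p<1\}$, horizon $\mathcal{E}=\{p=1\}$, $\overline{\mathcal{D}}=\{p\le1\}$, $\kappa(x)=(1-p(x)^{2c})^{-1}$ on $\mathcal{D}$. On $\mathcal{E}$, the $j$-th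 entry of $\nabla p(x)$ is $\frac{\beta_j}{c}x_j^{2\beta_j-1}$ for $j\in J$ and $0$ otherwise. On $\mathcal{D}$ put $\tilde f_i(x)=\kappa^{-(k+\alpha_i)}f_i(\kappa^{\Lambda_\alpha}x)$ and $\tilde f_{i;\mathrm{res}}(x)=\kappa^{-(k+\alpha_i)}f_{i;\mathrm{res}}(\kappa^{\Lambda_\alpha}x)$; $\tilde f$ is extended continuously to $\mathcal{E}$ by $\tilde f=f_{\alpha,k}$. Put $G(x)=\sum_{j\in J}\frac{x_j^{2\beta_j-1}}{\alpha_j}\tilde f_j(x)$. The desingularized vector field on $\overline{\mathcal{D}}$ is $$g(x)=\Big(1-\tfrac{2c-1}{2c}(1-p(x)^{2c})\Big)\tilde f(x)-G(x)\Lambda_\alpha x .$$ Derivatives of $\tilde f$ and $g$ at points of $\mathcal{E}$ are the continuous extensions of the derivatives from $\mathcal{D}$. An equilibrium on the horizon is $x_\ast\in\mathcal{E}$ with $g(x_\ast)=0$. $A$ is called the blow-up power-determining matrix associated with $Y_0$. "Remaining" eigenvalues and (generalized) eigenvectors are those other than the common ones. A generalized eigenvector of a matrix $M$ for an eigenvalue $\lambda$ is a nonzero vector in $\ker((M-\lambda I)^m)$ for some $m\ge1$.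
   Formalization: In (2), for λ=kC_*, r^Λ(A_g−kC_*I)u may vanish (then r^Λu is an eigenvector of A); remaining generalized eigenvectors of A for 1 are given as r^Λu instead. In (3), the 1×1 block of the common eigenvalue −C_* is removed from Dg(x_* ) before comparing. *)

theory Defs
  imports
    "HOL-Analysis.Analysis"
    "HOL-Library.Landau_Symbols"
    "Jordan_Normal_Form.Jordan_Normal_Form"
begin

no_notation Matrix.vec_index (infixl "$" 100)

section \<open>Quasi-homogeneous vector fields\<close>

text \<open>\<open>C_k r f\<close>: \<open>f\<close> is of class \<open>C\<^sup>r\<close> on the whole space.\<close>

primrec C_k :: "nat \<Rightarrow> (real^'n \<Rightarrow> real^'n) \<Rightarrow> bool" where
  "C_k 0 f \<longleftrightarrow> continuous_on UNIV f"
| "C_k (Suc r) f \<longleftrightarrow>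
     (\<forall>x. f differentiable (at x)) \<and> (\<forall>v. C_k r (\<lambda>x. frechet_derivative f (at x) v))"

definition diag :: "('n \<Rightarrow> 'a::zero) \<Rightarrow> 'a^'n^'n" where
  "diag d = (\<chi> i j. if i = j then d i else 0)"

definition Lam :: "('n \<Rightarrow> nat) \<Rightarrow> real^'n^'n" where
  "Lam \<alpha> = diag (\<lambda>i. real (\<alpha> i))"

text \<open>The matrix \<open>s\<^sup>\<Lambda>\<close>; its inverse \<open>s\<^sup>-\<^sup>\<Lambda>\<close> is \<open>spow \<alpha> (1 / s)\<close>.\<close>

definition spow :: "('n \<Rightarrow> nat) \<Rightarrow> real \<Rightarrow> real^'n^'n" where
  "spow \<alpha> s = diag (\<lambda>i. s ^ \<alpha> i)"

text \<open>Type \<open>\<alpha>\<close> and order \<open>k + 1\<close>.\<close>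

definition quasi_homogeneous :: "('n \<Rightarrow> nat) \<Rightarrow> real \<Rightarrow> (real^'n \<Rightarrow> real^'n) \<Rightarrow> bool" where
  "quasi_homogeneous \<alpha> k F \<longleftrightarrow>
     (\<forall>x. \<forall>s>0. \<forall>i. F (spow \<alpha> s *v x) $ i = s powr (k + real (\<alpha> i)) * F x $ i)"

definition asymp_quasi_homogeneous ::
  "('n \<Rightarrow> nat) \<Rightarrow> real \<Rightarrow> (real^'n \<Rightarrow> real^'n) \<Rightarrow> (real^'n \<Rightarrow> real^'n) \<Rightarrow> bool" where
  "asymp_quasi_homogeneous \<alpha> k f F \<longleftrightarrow> quasi_homogeneous \<alpha> k F \<and>
     (\<forall>i. uniform_limit (sphere 0 1)
        (\<lambda>s x. (f (spow \<alpha> s *v x) $ i - s powr (k + real (\<alpha> i)) * F x $ i)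
                / s powr (k + real (\<alpha> i)))
        (\<lambda>x. 0) at_top)"

section \<open>Quasi-parabolic compactification\<close>

definition J :: "('n \<Rightarrow> nat) \<Rightarrow> 'n set" where
  "J \<alpha> = {i. \<alpha> i > 0}"

definition c :: "('n::finite \<Rightarrow> nat) \<Rightarrow> nat" where
  "c \<alpha> = Lcm (\<alpha> ` J \<alpha>)"

definition \<beta> :: "('n::finite \<Rightarrow> nat) \<Rightarrow> 'n \<Rightarrow> nat" where
  "\<beta> \<alpha> i = c \<alpha> div \<alpha> i"

definition p :: "('n \<Rightarrow> nat) \<Rightarrow> real^'n \<Rightarrow> real" where
  "p \<alpha> x = (\<Sum>i\<in>J \<alpha>. (x $ i) ^ (2 * \<beta> \<alpha> i)) powr (1 / (2 * real (c \<alpha>)))"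

definition \<D> :: "('n \<Rightarrow> nat) \<Rightarrow> (real^'n) set" where
  "\<D> \<alpha> = {x. p \<alpha> x < 1}"

definition horizon :: "('n \<Rightarrow> nat) \<Rightarrow> (real^'n) set" where
  "horizon \<alpha> = {x. p \<alpha> x = 1}"

definition \<kappa> :: "('n \<Rightarrow> nat) \<Rightarrow> real^'n \<Rightarrow> real" where
  "\<kappa> \<alpha> x = 1 / (1 - p \<alpha> x ^ (2 * c \<alpha>))"

definition grad_p :: "('n \<Rightarrow> nat) \<Rightarrow> real^'n \<Rightarrow> real^'n" where
  "grad_p \<alpha> x = (\<chi> j. frechet_derivative (p \<alpha>) (at x) (axis j 1))"

definition rescale :: "('n \<Rightarrow> nat) \<Rightarrow> real \<Rightarrow> (real^'n \<Rightarrow> real^'n) \<Rightarrow> real^'n \<Rightarrow> real^'n" where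
  "rescale \<alpha> k h x =
     (\<chi> i. \<kappa> \<alpha> x powr (- (k + real (\<alpha> i))) * h (spow \<alpha> (\<kappa> \<alpha> x) *v x) $ i)"

text \<open>Only the values on \<open>\<D> \<union> horizon\<close> are meaningful; on the horizon, \<open>ftilde\<close> is the
  leading part \<open>F = f\<^sub>\<alpha>\<^sub>,\<^sub>k\<close>.\<close>

definition ftilde ::
  "('n \<Rightarrow> nat) \<Rightarrow> real \<Rightarrow> (real^'n \<Rightarrow> real^'n) \<Rightarrow> (real^'n \<Rightarrow> real^'n) \<Rightarrow> real^'n \<Rightarrow> real^'n" where
  "ftilde \<alpha> k f F x = (if x \<in> \<D> \<alpha> then rescale \<alpha> k f x else F x)"

definition ftilde_res ::
  "('n \<Rightarrow> nat) \<Rightarrow> real \<Rightarrow> (real^'n \<Rightarrow> real^'n) \<Rightarrow> (real^'n \<Rightarrow> real^'n) \<Rightarrow> real^'n \<Rightarrow> real^'n" where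
  "ftilde_res \<alpha> k f F = rescale \<alpha> k (\<lambda>x. f x - F x)"

definition G ::
  "('n \<Rightarrow> nat) \<Rightarrow> real \<Rightarrow> (real^'n \<Rightarrow> real^'n) \<Rightarrow> (real^'n \<Rightarrow> real^'n) \<Rightarrow> real^'n \<Rightarrow> real" where
  "G \<alpha> k f F x =
     (\<Sum>j\<in>J \<alpha>. (x $ j) ^ (2 * \<beta> \<alpha> j - 1) / real (\<alpha> j) * ftilde \<alpha> k f F x $ j)"

definition g ::
  "('n \<Rightarrow> nat) \<Rightarrow> real \<Rightarrow> (real^'n \<Rightarrow> real^'n) \<Rightarrow> (real^'n \<Rightarrow> real^'n) \<Rightarrow> real^'n \<Rightarrow> real^'n" where
  "g \<alpha> k f F x =
     (1 - (2 * real (c \<alpha>) - 1) / (2 * real (c \<alpha>)) * (1 - p \<alpha> x ^ (2 * c \<alpha>)))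
        *\<^sub>R ftilde \<alpha> k f F x
     - G \<alpha> k f F x *\<^sub>R (Lam \<alpha> *v x)"

text \<open>Jacobian matrix at a point of the horizon: limit of the Jacobian matrices in \<open>\<D>\<close>.\<close>

definition horizon_jacobian ::
  "('n \<Rightarrow> nat) \<Rightarrow> (real^'n \<Rightarrow> real^'n) \<Rightarrow> real^'n \<Rightarrow> real^'n^'n" where
  "horizon_jacobian \<alpha> h x = Lim (at x within \<D> \<alpha>) (\<lambda>y. jacobian h (at y))"

section \<open>Eigenvalues, generalized eigenvectors and Jordan blocks\<close>

abbreviation cmat :: "real^'n^'m \<Rightarrow> complex^'n^'m" where
  "cmat M \<equiv> map_matrix complex_of_real M"

definition cvec :: "real^'n \<Rightarrow> complex^'n" where
  "cvec v = (\<chi> i. complex_of_real (v $ i))"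

abbreviation scalar_mat :: "'a::zero \<Rightarrow> 'a^'n^'n" where
  "scalar_mat \<equiv> Finite_Cartesian_Product.mat"

text \<open>\<open>v\<close> is a nonzero vector in the kernel of \<open>(M - \<nu> I)\<^sup>m\<close>; eigenvectors are the case \<open>m = 1\<close>.\<close>

definition gen_eigenvector :: "complex^'n^'n \<Rightarrow> complex \<Rightarrow> nat \<Rightarrow> complex^'n \<Rightarrow> bool" where
  "gen_eigenvector M \<nu> m v \<longleftrightarrow>
     m \<ge> 1 \<and> v \<noteq> 0 \<and> ((\<lambda>w. (M - scalar_mat \<nu>) *v w) ^^ m) v = 0"

text \<open>The index type is enumerated in a fixed but arbitrary way; characteristic polynomial and
  Jordan normal form do not depend on the enumeration.\<close>

definition jnf_mat :: "'a^'n^'n \<Rightarrow> 'a Matrix.mat" where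
  "jnf_mat M = Matrix.mat CARD('n) CARD('n)
     (\<lambda>(i, j). M $ from_nat_into UNIV i $ from_nat_into UNIV j)"

text \<open>Eigenvalues counted with algebraic multiplicity.\<close>

definition eigenvalues_mset :: "complex^'n^'n \<Rightarrow> complex multiset" where
  "eigenvalues_mset M = proots (char_poly (jnf_mat M))"

end

theory Submission
  imports
    Defs
    "Jordan_Normal_Form.Jordan_Normal_Form_Uniqueness"
    "Jordan_Normal_Form.Jordan_Normal_Form_Existence"
begin

text \<open>Write \<open>v = \<Lambda> x\<^sub>*\<close> and \<open>w = \<nabla>p(x\<^sub>*)\<close>, so that \<open>w\<^sup>T v = 1\<close> and \<open>P\<^sub>* = v w\<^sup>T\<close> is a projection. The
  decay of the residual terms makes the derivative of \<open>f\<^sub>\<alpha>\<^sub>,\<^sub>k\<close> at \<open>x\<^sub>*\<close> the continuous extension of that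
  of \<open>ftilde\<close>; with \<open>f\<^sub>\<alpha>\<^sub>,\<^sub>k(x\<^sub>*) = C\<^sub>* v\<close> at an equilibrium, the product rule yields
  \<open>Dg(x\<^sub>*) = (I - P\<^sub>*) A\<^sub>g - C\<^sub>* P\<^sub>*\<close>. Euler's identity gives \<open>A\<^sub>g v = k C\<^sub>* v\<close>, and differentiating the
  quasi-homogeneity relation shows that \<open>A\<close> is similar to \<open>A\<^sub>g / (k C\<^sub>*)\<close> via \<open>r\<^sup>\<Lambda>\<close>. Hence in a basis
  consisting of \<open>v\<close> and vectors of \<open>ker w\<^sup>T\<close> both matrices are block triangular with the same lower
  block up to the factor \<open>k C\<^sub>*\<close>: \<open>Dg(x\<^sub>*)\<close> replaces the eigenvalue \<open>k C\<^sub>*\<close> of \<open>A\<^sub>g\<close> on \<open>v\<close> by \<open>-C\<^sub>*\<close> and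
  decouples \<open>v\<close> from the rest.\<close>

no_notation Matrix.vec_index (infixl "$" 100)

section \<open>Jordan structure of block triangular matrices\<close>

text \<open>Only the diagonal blocks of a power matter for the kernel dimensions below, so the upper
  right block stays existential.\<close>

lemma pow_four_block_upper_triangular:
  fixes M :: "'a::semiring_1 Matrix.mat"
  assumes M: "M \<in> carrier_mat n n" and Z: "Z \<in> carrier_mat n m" and N: "N \<in> carrier_mat m m"
  shows "\<exists>X \<in> carrier_mat n m. four_block_mat M Z (0\<^sub>m m n) N ^\<^sub>m j =
    four_block_mat (M ^\<^sub>m j) X (0\<^sub>m m n) (N ^\<^sub>m j)"
proof (induct j)
  case 0
  show ?case using M N by (intro bexI[of _ "0\<^sub>m n m"]) auto
next
  case (Suc j)
  then obtain X where X: "X \<in> carrier_mat n m" and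
    eq: "four_block_mat M Z (0\<^sub>m m n) N ^\<^sub>m j =
      four_block_mat (M ^\<^sub>m j) X (0\<^sub>m m n) (N ^\<^sub>m j)" by blast
  have "four_block_mat M Z (0\<^sub>m m n) N ^\<^sub>m Suc j =
    four_block_mat (M ^\<^sub>m Suc j) (M ^\<^sub>m j * Z + X * N) (0\<^sub>m m n) (N ^\<^sub>m Suc j)"
    unfolding pow_mat.simps eq
    by (subst mult_four_block_mat[OF _ X _ _ M Z _ N])
       (use M N X Z in \<open>auto intro!: cong_four_block_mat\<close>)
  then show ?case using M N X Z
    by (intro bexI[of _ "M ^\<^sub>m j * Z + X * N"]) auto
qed

text \<open>The matrix factors as the block diagonal matrix \<open>?D\<close> times the invertible
  matrix \<open>?R\<close>, which absorbs \<open>Z\<close>; an invertible right factor preserves the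
  dimension of the kernel.\<close>

lemma kernel_dim_four_block_unit:
  fixes N :: "'a::field Matrix.mat"
  assumes a: "a \<noteq> 0" and Z: "Z \<in> carrier_mat 1 m" and N: "N \<in> carrier_mat m m"
  shows "kernel.dim (1 + m) (four_block_mat (a \<cdot>\<^sub>m 1\<^sub>m 1) Z (0\<^sub>m m 1) N) = kernel.dim m N"
proof -
  let ?D = "four_block_mat (1\<^sub>m 1) (0\<^sub>m 1 m) (0\<^sub>m m 1) N"
  let ?R = "four_block_mat (a \<cdot>\<^sub>m 1\<^sub>m 1) Z (0\<^sub>m m 1) (1\<^sub>m m)"
  let ?S = "four_block_mat (inverse a \<cdot>\<^sub>m 1\<^sub>m 1) (- inverse a \<cdot>\<^sub>m Z) (0\<^sub>m m 1) (1\<^sub>m m)"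
  have one: "1\<^sub>m 1 \<in> carrier_mat 1 1" by simp
  have DR: "?D * ?R = four_block_mat (a \<cdot>\<^sub>m 1\<^sub>m 1) Z (0\<^sub>m m 1) N"
    by (subst mult_four_block_mat[OF _ _ _ N _ Z])
       (use N Z in \<open>auto intro!: cong_four_block_mat\<close>)
  have RS: "?R * ?S = 1\<^sub>m (1 + m)"
    by (subst mult_four_block_mat[OF _ Z])
       (use a Z in \<open>auto intro!: eq_matI simp: scalar_prod_def dest: eq_diff_iff[THEN iffD1, rotated 2]\<close>)
  have "kernel.dim (1 + m) (?D * ?R) = kernel.dim (1 + m) ?D"
    by (rule mat_kernel_dim_mult_eq_right[OF _ _ _ RS]) (use N Z in \<open>auto intro!: four_block_carrier_mat\<close>)
  also have "\<dots> = kernel.dim 1 (1\<^sub>m 1 :: 'a Matrix.mat) + kernel.dim m N"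
    by (rule kernel_four_block_0_mat[OF refl one N])
  finally show ?thesis unfolding DR by (simp add: kernel_one_mat)
qed

text \<open>Subtracting \<open>ev\<close> leaves the nonzero scalar \<open>a - ev\<close> in the
  corner, its powers stay nonzero, and a nonsingular corner adds nothing to the kernel. Hence Jordan
  blocks for eigenvalues other than \<open>a\<close> do not see \<open>Z\<close>.\<close>

lemma dim_gen_eigenspace_four_block:
  fixes N :: "'a::field Matrix.mat"
  assumes "a \<noteq> ev" and Z: "Z \<in> carrier_mat 1 m" and N: "N \<in> carrier_mat m m"
  shows "dim_gen_eigenspace (four_block_mat (a \<cdot>\<^sub>m 1\<^sub>m 1) Z (0\<^sub>m m 1) N) ev j =
    dim_gen_eigenspace N ev j"
proof -
  let ?M = "four_block_mat (a \<cdot>\<^sub>m 1\<^sub>m 1) Z (0\<^sub>m m 1) N"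
  have cm: "char_matrix ?M ev =
      four_block_mat ((a - ev) \<cdot>\<^sub>m 1\<^sub>m 1) Z (0\<^sub>m m 1) (char_matrix N ev)"
    using Z N by (auto simp: char_matrix_def intro!: eq_matI)
  have cN: "char_matrix N ev \<in> carrier_mat m m" using N by simp
  obtain X where X: "X \<in> carrier_mat 1 m" and
    pw: "char_matrix ?M ev ^\<^sub>m j = four_block_mat (((a - ev) \<cdot>\<^sub>m 1\<^sub>m 1) ^\<^sub>m j) X (0\<^sub>m m 1)
        (char_matrix N ev ^\<^sub>m j)"
    using pow_four_block_upper_triangular[of "(a - ev) \<cdot>\<^sub>m 1\<^sub>m 1" 1 Z m "char_matrix N ev" j] Z cN
    unfolding cm by auto
  have sp: "((a - ev) \<cdot>\<^sub>m 1\<^sub>m 1) ^\<^sub>m j = (a - ev) ^ j \<cdot>\<^sub>m 1\<^sub>m 1"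
  proof (induct j)
    case (Suc j)
    then show ?case by (auto intro!: eq_matI simp: scalar_prod_def)
  qed (auto intro!: eq_matI)
  have car: "char_matrix N ev ^\<^sub>m j \<in> carrier_mat m m" using cN by simp
  have "kernel.dim (1 + m) (char_matrix ?M ev ^\<^sub>m j) = kernel.dim m (char_matrix N ev ^\<^sub>m j)"
    unfolding pw sp by (rule kernel_dim_four_block_unit[OF _ X car]) (use assms in simp)
  moreover have "dim_col (char_matrix ?M ev ^\<^sub>m j) = 1 + m" unfolding pw using carrier_matD[OF cN] by (simp add: sp)
  moreover have "dim_col (char_matrix N ev ^\<^sub>m j) = m" by (rule carrier_matD(2)[OF car])
  ultimately show ?thesis unfolding dim_gen_eigenspace_def kernel_dim_def by simp
qed

text \<open>The number of blocks of a given size is computed from dimensions of generalized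
  eigenspaces alone. Size \<open>0\<close> is separate because the blocks of a Jordan normal form
  have positive size.\<close>

lemma count_jordan_nf:
  assumes "jordan_nf M bs"
  shows "count (mset bs) (m, ev) = (if m = 0 then 0 else compute_nr_of_jordan_blocks M ev m)"
proof (cases "m = 0")
  case True
  then have "(m, ev) \<notin> set bs" using assms unfolding jordan_nf_def by force
  then show ?thesis using True by (simp add: count_eq_zero_iff)
next
  case False
  have "count (mset bs) (m, ev) = length (filter ((=) (m, ev)) bs)"
    by (induct bs) auto
  then show ?thesis using compute_nr_of_jordan_blocks[OF assms False, of ev] False by simp
qed

lemma mset_jordan_nf_unique:
  assumes "jordan_nf (M :: 'a::field Matrix.mat) bs" "jordan_nf M bs'"
  shows "mset bs = mset bs'"
proof (rule multiset_eqI)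
  fix b show "count (mset bs) b = count (mset bs') b"
    by (cases b) (simp add: count_jordan_nf[OF assms(1)] count_jordan_nf[OF assms(2)])
qed

lemma proots_char_poly_jordan_nf:
  assumes "jordan_nf (M :: 'a::field Matrix.mat) bs"
  shows "proots (char_poly M) = (\<Sum>(n, a)\<leftarrow>bs. replicate_mset n a)"
proof -
  have "proots (\<Prod>(n, a)\<leftarrow>bs. [:- a, 1:] ^ n) = (\<Sum>(n, a)\<leftarrow>bs. replicate_mset n a)"
  proof (induct bs)
    case (Cons b bs)
    have "(\<Prod>(n, a)\<leftarrow>bs. [:- a, 1:] ^ n) \<noteq> 0" by (auto simp: prod_list_zero_iff)
    then show ?case using Cons by (cases b) (simp add: proots_mult proots_power)
  qed simp
  then show ?thesis using jordan_nf_char_poly[OF assms] by simp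
qed

text \<open>Both block matrices share the block \<open>N\<close> up to the scaling; the upper triangular one is
  handled by dimensions of generalized eigenspaces, the diagonal one by an explicit normal form.\<close>

lemma jordan_structure_blocks:
  fixes M D N :: "complex Matrix.mat"
  assumes M: "similar_mat M (four_block_mat (a \<cdot>\<^sub>m 1\<^sub>m 1) Z (0\<^sub>m m 1) N)"
    and D: "similar_mat D (four_block_mat (d \<cdot>\<^sub>m 1\<^sub>m 1) (0\<^sub>m 1 m) (0\<^sub>m m 1) (s \<cdot>\<^sub>m N))"
    and Z: "Z \<in> carrier_mat 1 m" and N: "N \<in> carrier_mat m m" and s: "s \<noteq> 0"
  shows "\<exists>E. proots (char_poly M) = add_mset a E \<and>
      proots (char_poly D) = add_mset d (image_mset ((*) s) E)"
    and "jordan_nf D bD \<Longrightarrow> (1, d) \<in># mset bD"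
    and "\<lbrakk>jordan_nf M bM; jordan_nf D bD; \<mu> \<noteq> a\<rbrakk> \<Longrightarrow>
      count (mset bM) (j, \<mu>) = count (mset bD - {#(1, d)#}) (j, s * \<mu>)"
proof -
  \<comment> \<open>Over the complex numbers \<open>N\<close> has a Jordan form; scaling by
    \<open>s\<close> keeps the block sizes and multiplies the eigenvalues.\<close>
  obtain es where "char_poly N = (\<Prod>e\<leftarrow>es. [:- e, 1:])"
    using char_poly_factorized[OF N] by blast
  then obtain bN where bN: "jordan_nf N bN"
    using jordan_nf_exists[OF N] by blast
  let ?sN = "map (\<lambda>(n, a). (n, s * a)) bN"
  have bsN: "jordan_nf (s \<cdot>\<^sub>m N) ?sN" by (rule jordan_nf_smult[OF bN s])
  have sN: "s \<cdot>\<^sub>m N \<in> carrier_mat m m" using N by simp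
  have one: "(d \<cdot>\<^sub>m 1\<^sub>m 1) \<in> carrier_mat 1 1" by simp
  have jb: "jordan_block 1 d = d \<cdot>\<^sub>m 1\<^sub>m 1" by (auto intro!: eq_matI)
  have sim: "similar_mat (s \<cdot>\<^sub>m N) (jordan_matrix ?sN)" using bsN unfolding jordan_nf_def by auto
  have len: "sum_list (map fst ?sN) = m"
  proof -
    have "jordan_matrix ?sN \<in> carrier_mat m m"
      using similar_matD[OF sim] sN by auto
    then show ?thesis by (metis carrier_matD(1) jordan_matrix_carrier)
  qed
  have "similar_mat (four_block_mat (d \<cdot>\<^sub>m 1\<^sub>m 1) (0\<^sub>m 1 m) (0\<^sub>m m 1) (s \<cdot>\<^sub>m N))
      (jordan_matrix ((1, d) # ?sN))"
    unfolding jordan_matrix_Cons len jb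
    by (rule similar_mat_four_block_0_0[OF similar_mat_refl[OF one] sim one sN])
  then have "similar_mat D (jordan_matrix ((1, d) # ?sN))"
    using D similar_mat_trans by blast
  then have nfD: "jordan_nf D ((1, d) # ?sN)"
    using bsN unfolding jordan_nf_def by auto
  {
    assume "jordan_nf D bD"
    then have msD: "mset bD = add_mset (1, d) (mset ?sN)"
      using mset_jordan_nf_unique[OF _ nfD] by simp
    then show "(1, d) \<in># mset bD" by simp
    assume bM: "jordan_nf M bM" and \<mu>: "\<mu> \<noteq> a"
    \<comment> \<open>The coupling \<open>Z\<close> can alter block sizes only at the eigenvalue
      \<open>a\<close>; elsewhere the counts come from \<open>N\<close>.\<close>
    have "dim_gen_eigenspace M \<mu> i = dim_gen_eigenspace N \<mu> i" for i
      unfolding dim_gen_eigenspace_similar[OF M]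
      by (rule dim_gen_eigenspace_four_block[OF _ Z N]) (use \<mu> in simp)
    then have "count (mset bM) (j, \<mu>) = count (mset bN) (j, \<mu>)"
      unfolding count_jordan_nf[OF bM] count_jordan_nf[OF bN] compute_nr_of_jordan_blocks_def by simp
    also have "\<dots> = count (mset ?sN) (j, s * \<mu>)"
      using s by (induct bN) auto
    finally show "count (mset bM) (j, \<mu>) = count (mset bD - {#(1, d)#}) (j, s * \<mu>)"
      unfolding msD by simp
  }
  \<comment> \<open>Algebraic multiplicities, unlike block sizes, ignore \<open>Z\<close> even at
    \<open>a\<close>.\<close>
  have "char_poly M = char_poly (a \<cdot>\<^sub>m 1\<^sub>m 1) * char_poly N"
    unfolding char_poly_similar[OF M] by (rule char_poly_four_block_zeros_col[OF _ Z N]) simp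
  also have "char_poly (a \<cdot>\<^sub>m 1\<^sub>m 1) = [:- a, 1:]"
    by (subst char_poly_upper_triangular[of _ 1]) (auto simp: diag_mat_def)
  finally have cM: "char_poly M = [:- a, 1:] * char_poly N" .
  have "char_poly N \<noteq> 0" using degree_monic_char_poly[OF N] by auto
  then have "proots (char_poly M) = add_mset a (proots (char_poly N))"
    unfolding cM by (subst proots_mult) simp_all
  moreover have "proots (char_poly D) = add_mset d (image_mset ((*) s) (proots (char_poly N)))"
    unfolding proots_char_poly_jordan_nf[OF nfD] proots_char_poly_jordan_nf[OF bN]
    by (simp, induct bN, auto)
  ultimately show "\<exists>E. proots (char_poly M) = add_mset a E \<and>
      proots (char_poly D) = add_mset d (image_mset ((*) s) E)" by blast
qed

section \<open>From indexed matrices to block form\<close>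

lemma jnf_mat_mult: "jnf_mat (M ** N) = jnf_mat M * jnf_mat (N :: 'a::comm_semiring_1^'n::finite^'n)"
proof -
  have bij: "bij_betw (from_nat_into (UNIV :: 'n set)) {..<CARD('n)} UNIV"
    using bij_betw_from_nat_into_finite[of "UNIV :: 'n set"] by simp
  show ?thesis
    by (rule eq_matI)
      (auto simp: jnf_mat_def matrix_matrix_mult_def scalar_prod_def
          sum.reindex_bij_betw[OF bij, symmetric] atLeast0LessThan)
qed

lemma jnf_mat_one: "jnf_mat (scalar_mat 1 :: 'a::comm_semiring_1^'n::finite^'n) = 1\<^sub>m CARD('n)"
proof -
  have bij: "bij_betw (from_nat_into (UNIV :: 'n set)) {..<CARD('n)} UNIV"
    using bij_betw_from_nat_into_finite[of "UNIV :: 'n set"] by simp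
  show ?thesis
    by (rule eq_matI) (auto simp: jnf_mat_def Finite_Cartesian_Product.mat_def
      dest: inj_onD[OF bij_betw_imp_inj_on[OF bij]])
qed

lemma jnf_mat_similar:
  fixes M S T :: "'a::comm_ring_1^'n::finite^'n"
  assumes "S ** T = scalar_mat 1" "T ** S = scalar_mat 1"
  shows "similar_mat (jnf_mat M) (jnf_mat (T ** M ** S))"
proof -
  have "jnf_mat M = jnf_mat S * jnf_mat (T ** M ** S) * jnf_mat T"
    using assms by (simp flip: jnf_mat_mult add: matrix_mul_assoc)
      (simp flip: matrix_mul_assoc add: assms)
  then have "similar_mat_wit (jnf_mat M) (jnf_mat (T ** M ** S)) (jnf_mat S) (jnf_mat T)"
    using assms unfolding similar_mat_wit_def Let_def
    by (simp flip: jnf_mat_mult) (simp add: jnf_mat_one, simp add: jnf_mat_def)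
  then show ?thesis unfolding similar_mat_def by blast
qed

lemma matrix_vector_mult_axis: "M *v axis j 1 = column j (M :: 'a::semiring_1^'n::finite^'m)"
  by (simp add: matrix_vector_mult_def column_def axis_def Finite_Cartesian_Product.vec_eq_iff
      if_distrib[of "(*) (M $ i $ k)" for i k] cong: if_cong)

text \<open>Column \<open>j\<close> of \<open>S\<close> is \<open>v\<close>; the other columns are a
  basis of the kernel of \<open>w\<close>, namely unit vectors corrected along a coordinate
  \<open>i0\<close> where \<open>w\<close> does not vanish. The transposition of \<open>j\<close>
  and \<open>i0\<close> makes the indices of these unit vectors avoid \<open>i0\<close>.\<close>

lemma exists_basis_adapted:
  fixes v w :: "'a::field^'n::finite" and j :: 'n
  assumes "(\<Sum>i\<in>UNIV. w $ i * v $ i) = 1"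
  shows "\<exists>S T. S ** T = scalar_mat 1 \<and> T ** S = scalar_mat 1 \<and>
    S *v axis j 1 = v \<and> w v* S = axis j 1"
proof -
  obtain i0 where i0: "w $ i0 \<noteq> 0"
    using assms by fastforce
  let ?\<tau> = "Transposition.transpose j i0"
  define S :: "'a^'n^'n" where "S = (\<chi> i l. if l = j then v $ i else
      (if i = ?\<tau> l then 1 else 0) - (if i = i0 then w $ ?\<tau> l / w $ i0 else 0))"
  have Sv: "S *v axis j 1 = v"
    by (simp add: matrix_vector_mult_axis column_def S_def Finite_Cartesian_Product.vec_eq_iff)
  have wS: "w v* S = axis j 1"
  proof -
    have "(\<Sum>i\<in>UNIV. w $ i * ((if i = ?\<tau> l then 1 else 0) - (if i = i0 then w $ ?\<tau> l / w $ i0 else 0))) = 0" for l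
      using i0 by (simp add: right_diff_distrib sum_subtractf if_distrib[of "(*) (w $ i)" for i] cong: if_cong)
    then show ?thesis using assms
      by (auto simp: vector_matrix_mult_def S_def axis_def Finite_Cartesian_Product.vec_eq_iff mult.commute)
  qed
  \<comment> \<open>Pairing \<open>S *v x = 0\<close> with \<open>w\<close> isolates coordinate
    \<open>j\<close>; any other coordinate \<open>l\<close> is then read off in row
    \<open>?\<tau> l\<close>, which differs from \<open>i0\<close>.\<close>
  have "\<forall>x. S *v x = 0 \<longrightarrow> x = 0"
  proof (intro allI impI)
    fix x assume x: "S *v x = 0"
    have "(\<Sum>i\<in>UNIV. w $ i * (S *v x) $ i) = (\<Sum>l\<in>UNIV. (w v* S) $ l * x $ l)"
      unfolding matrix_vector_mult_def vector_matrix_mult_def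
      by (simp add: sum_distrib_left sum_distrib_right mult_ac) (rule sum.swap)
    then have xj: "x $ j = 0" using x
      by (simp add: wS axis_def if_distrib[of "\<lambda>y. y * x $ i" for i] cong: if_cong)
    have "x $ l = 0" if "l \<noteq> j" for l
    proof -
      have ne: "?\<tau> l \<noteq> i0" using that
        by (metis transpose_apply_second transpose_involutory)
      have "0 = (S *v x) $ ?\<tau> l" using x by simp
      also have "\<dots> = (\<Sum>m\<in>UNIV. if m = l then x $ m else 0)"
        unfolding matrix_vector_mult_def S_def vec_lambda_beta
      proof (rule sum.cong[OF refl])
        fix m
        show "(if m = j then v $ ?\<tau> l else (if ?\<tau> l = ?\<tau> m then 1 else 0) -
            (if ?\<tau> l = i0 then w $ ?\<tau> m / w $ i0 else 0)) * x $ m = (if m = l then x $ m else 0)"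
          using xj ne by (cases "m = j"; cases "m = l") (auto dest: transpose_eq_imp_eq)
      qed
      finally show ?thesis by simp
    qed
    then have "x $ l = 0" for l using xj by (cases "l = j") auto
    then show "x = 0" by (simp add: Finite_Cartesian_Product.vec_eq_iff)
  qed
  then obtain T where TS: "T ** S = scalar_mat 1"
    using matrix_left_invertible_ker[THEN iffD2] by blast
  then have "S ** T = scalar_mat 1" by (rule matrix_left_right_inverse[THEN iffD1])
  then show ?thesis using TS Sv wS by (intro exI conjI)
qed

text \<open>The eigenvector direction is the first index of the enumeration, which puts its
  eigenvalue into the top left corner. The blocks are explicit submatrices so that those of two
  matrices can be compared entrywise.\<close>

lemma four_block_jnf_mat:
  fixes M :: "'a::comm_ring_1^'n::finite^'n"
  defines "j \<equiv> from_nat_into UNIV 0 :: 'n"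
  assumes col: "M *v axis j 1 = a *s axis j 1"
  obtains Z N where "Z \<in> carrier_mat 1 (CARD('n) - 1)" "N \<in> carrier_mat (CARD('n) - 1) (CARD('n) - 1)"
    "jnf_mat M = four_block_mat (a \<cdot>\<^sub>m 1\<^sub>m 1) Z (0\<^sub>m (CARD('n) - 1) 1) N"
    "N = Matrix.mat (CARD('n) - 1) (CARD('n) - 1) (\<lambda>(i, l). jnf_mat M $$ (Suc i, Suc l))"
    "Z = Matrix.mat 1 (CARD('n) - 1) (\<lambda>(i, l). jnf_mat M $$ (0, Suc l))"
proof -
  let ?m = "CARD('n) - 1"
  define e where "e = from_nat_into (UNIV :: 'n set)"
  have bij: "bij_betw e {..<CARD('n)} UNIV"
    using bij_betw_from_nat_into_finite[of "UNIV :: 'n set"] by (simp add: e_def)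
  have e0: "e i = j \<longleftrightarrow> i = 0" if "i < CARD('n)" for i
    using inj_onD[OF bij_betw_imp_inj_on[OF bij], of i 0] that by (auto simp: j_def e_def)
  have col': "M $ i $ j = (if i = j then a else 0)" for i
    using arg_cong[OF col, of "\<lambda>x. x $ i"]
    unfolding matrix_vector_mult_axis by (auto simp: column_def axis_def)
  have col0: "jnf_mat M $$ (i, 0) = (if i = 0 then a else 0)" if "i < CARD('n)" for i
    using that e0[OF that] col'[of "e i"] by (simp add: jnf_mat_def e_def j_def)
  show ?thesis
  proof (rule that[OF _ _ _ refl refl])
    show "jnf_mat M = four_block_mat (a \<cdot>\<^sub>m 1\<^sub>m 1)
       (Matrix.mat 1 ?m (\<lambda>(i, l). jnf_mat M $$ (0, Suc l))) (0\<^sub>m ?m 1)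
       (Matrix.mat ?m ?m (\<lambda>(i, l). jnf_mat M $$ (Suc i, Suc l)))" (is "_ = ?R")
    proof (rule eq_matI)
      fix i l assume "i < dim_row ?R" "l < dim_col ?R"
      then have il: "i < CARD('n)" "l < CARD('n)" by auto
      show "jnf_mat M $$ (i, l) = ?R $$ (i, l)"
        using il col0[OF il(1)] by (cases i; cases l) auto
    qed (auto simp: jnf_mat_def)
  qed simp_all
qed

text \<open>In the adapted basis the common eigenvector \<open>v\<close> becomes
  \<open>axis j 1\<close> and clears the first column of both matrices, while the left eigenvector
  \<open>w\<close> clears the first row of \<open>D\<close>. Every column of the correction with
  \<open>z\<close> is a multiple of \<open>v\<close>, so it reaches only that row, and the lower
  block of \<open>D\<close> is \<open>s\<close> times that of \<open>A\<close>.\<close>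

lemma similar_common_four_block:
  fixes A D :: "complex^'n::finite^'n"
  assumes wv: "(\<Sum>i\<in>UNIV. w $ i * v $ i) = 1"
    and Av: "A *v v = a *s v" and Dv: "D *v v = d *s v" and wD: "w v* D = d *s w"
    and D: "\<And>i l. D $ i $ l = s * A $ i $ l - v $ i * z $ l"
  obtains Z N m where "Z \<in> carrier_mat 1 m" "N \<in> carrier_mat m m"
    "similar_mat (jnf_mat A) (four_block_mat (a \<cdot>\<^sub>m 1\<^sub>m 1) Z (0\<^sub>m m 1) N)"
    "similar_mat (jnf_mat D) (four_block_mat (d \<cdot>\<^sub>m 1\<^sub>m 1) (0\<^sub>m 1 m) (0\<^sub>m m 1) (s \<cdot>\<^sub>m N))"
proof -
  let ?m = "CARD('n) - 1"
  define j where "j = (from_nat_into UNIV 0 :: 'n)"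
  obtain S T where ST: "S ** T = scalar_mat 1" and TS: "T ** S = scalar_mat 1"
    and Sj: "S *v axis j 1 = v" and wS: "w v* S = axis j 1"
    using exists_basis_adapted[OF wv, of j] by metis
  have Tv: "T *v v = axis j 1"
    unfolding Sj[symmetric] matrix_vector_mul_assoc TS by simp
  have Tw: "axis j 1 v* T = w"
    unfolding wS[symmetric] vector_matrix_mul_assoc ST by simp
  let ?A = "T ** A ** S" and ?D = "T ** D ** S"
  have A': "?A *v axis j 1 = a *s axis j 1"
    by (simp flip: matrix_vector_mul_assoc add: Sj Av Tv vec.scale)
  have D': "?D *v axis j 1 = d *s axis j 1"
    by (simp flip: matrix_vector_mul_assoc add: Sj Dv Tv vec.scale)
  have "axis j 1 v* ?D = d *s axis j 1"
    by (simp flip: vector_matrix_mul_assoc add: Tw wD wS)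
      (simp add: wS[symmetric] vector_matrix_mult_def Finite_Cartesian_Product.vec_eq_iff sum_distrib_left mult_ac)
  then have rowD: "?D $ j $ l = (if l = j then d else 0)" for l
    by (auto simp: vector_matrix_mult_def axis_def Finite_Cartesian_Product.vec_eq_iff
      if_distrib[of "\<lambda>y. y * ?D $ i $ l" for i l] cong: if_cong)
  have DA: "?D $ i $ l = s * ?A $ i $ l" if "i \<noteq> j" for i l
  proof -
    have "(T ** D) $ i $ l = s * (T ** A) $ i $ l - (T *v v) $ i * z $ l" for l
      by (simp add: matrix_matrix_mult_def matrix_vector_mult_def D algebra_simps
        sum_subtractf sum_distrib_left)
    then have "(T ** D) $ i $ l = s * (T ** A) $ i $ l" for l
      using that by (simp add: Tv axis_def)
    then show ?thesis
      by (simp add: matrix_matrix_mult_def[of _ S] sum_distrib_left mult_ac)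
  qed
  obtain Z N where Z: "Z \<in> carrier_mat 1 ?m" and N: "N \<in> carrier_mat ?m ?m" and
    fA: "jnf_mat ?A = four_block_mat (a \<cdot>\<^sub>m 1\<^sub>m 1) Z (0\<^sub>m ?m 1) N" and
    N_def: "N = Matrix.mat ?m ?m (\<lambda>(i, l). jnf_mat ?A $$ (Suc i, Suc l))"
    using four_block_jnf_mat[OF A'[unfolded j_def]] by metis
  obtain Z' N' where
    fD: "jnf_mat ?D = four_block_mat (d \<cdot>\<^sub>m 1\<^sub>m 1) Z' (0\<^sub>m ?m 1) N'" and
    N'_def: "N' = Matrix.mat ?m ?m (\<lambda>(i, l). jnf_mat ?D $$ (Suc i, Suc l))" and
    Z'_def: "Z' = Matrix.mat 1 ?m (\<lambda>(i, l). jnf_mat ?D $$ (0, Suc l))"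
    using four_block_jnf_mat[OF D'[unfolded j_def]] by metis
  have ne: "from_nat_into UNIV (Suc i) \<noteq> j" if "i < ?m" for i
    using inj_onD[OF bij_betw_imp_inj_on[OF bij_betw_from_nat_into_finite[of "UNIV :: 'n set"]], of "Suc i" 0]
      less_diff_conv[of i "CARD('n)" 1] that by (auto simp: j_def)
  have "N' = s \<cdot>\<^sub>m N"
    by (rule eq_matI) (use DA ne in \<open>auto simp: N_def N'_def jnf_mat_def\<close>)
  moreover have "Z' = 0\<^sub>m 1 ?m"
    by (rule eq_matI) (use rowD ne in \<open>auto simp: Z'_def jnf_mat_def simp flip: j_def\<close>)
  ultimately show ?thesis
    using that[OF Z N] fA fD jnf_mat_similar[OF ST TS, of A] jnf_mat_similar[OF ST TS, of D] by metis
qed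

section \<open>Generalized eigenvectors under deflation\<close>

abbreviation shift_pow :: "'a::field^'n::finite^'n \<Rightarrow> 'a \<Rightarrow> nat \<Rightarrow> 'a^'n \<Rightarrow> 'a^'n" where
  "shift_pow M \<nu> m \<equiv> (\<lambda>x. (M - scalar_mat \<nu>) *v x) ^^ m"

lemma shift_apply: "(M - scalar_mat \<nu>) *v x = M *v x - \<nu> *s (x :: 'a::field^'n::finite)"
proof -
  have "scalar_mat \<nu> *v x = \<nu> *s x"
    by (simp add: matrix_vector_mult_def Finite_Cartesian_Product.mat_def
        Finite_Cartesian_Product.vec_eq_iff if_distrib[of "\<lambda>y. y * x $ i" for i] cong: if_cong)
  then show ?thesis by (simp add: matrix_vector_mult_diff_rdistrib)
qed

lemma shift_pow_diff: "shift_pow M \<nu> m (x - y) = shift_pow M \<nu> m x - shift_pow M \<nu> m y"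
  by (induct m) (simp_all add: matrix_vector_mult_diff_distrib)

lemma shift_pow_scale: "shift_pow M \<nu> m (a *s x) = a *s shift_pow M \<nu> m x"
  by (induct m) (simp_all add: vector_scalar_commute)

lemma shift_pow_commute:
  "(M - scalar_mat \<mu>) *v shift_pow M \<nu> m x = shift_pow M \<nu> m ((M - scalar_mat \<mu>) *v x)"
proof (induct m)
  case (Suc m)
  have "(M - scalar_mat \<mu>) *v ((M - scalar_mat \<nu>) *v y) = (M - scalar_mat \<nu>) *v ((M - scalar_mat \<mu>) *v y)" for y
    by (simp add: shift_apply matrix_vector_mult_diff_distrib vector_scalar_commute
        vector_ssub_ldistrib vector_smult_assoc mult.commute)
  then show ?case using Suc by simp
qed simp

lemma shift_pow_eigenvector:
  assumes "M *v x = a *s x"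
  shows "shift_pow M \<nu> m x = (a - \<nu>) ^ m *s x"
proof (induct m)
  case (Suc m)
  have "(M - scalar_mat \<nu>) *v x = (a - \<nu>) *s x"
    by (simp add: shift_apply assms vector_sub_rdistrib)
  then show ?case using Suc
    by (simp add: vector_scalar_commute vector_smult_assoc mult.commute del: vector_sub_rdistrib)
qed simp

text \<open>\<open>M\<close> is similar to \<open>inverse a\<close> times \<open>B\<close>; each
  shifted application picks up the nonzero factor \<open>inverse a\<close>, which does not affect
  the kernel of the power.\<close>

lemma gen_eigenvector_conjugate:
  assumes ST: "S ** T = scalar_mat 1" and TS: "T ** S = scalar_mat 1"
    and a: "a \<noteq> 0" and M: "\<And>x. M *v (S *v x) = inverse a *s (S *v (B *v x))"
  shows "gen_eigenvector M \<mu> m (S *v x) \<longleftrightarrow> gen_eigenvector B (a * \<mu>) m x"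
proof -
  have inj: "S *v y = 0 \<longleftrightarrow> y = 0" for y
  proof
    assume "S *v y = 0"
    then have "T *v (S *v y) = 0" by simp
    then show "y = 0" by (simp add: matrix_vector_mul_assoc TS)
  qed simp
  have "(M - scalar_mat \<mu>) *v (S *v y) = inverse a *s (S *v ((B - scalar_mat (a * \<mu>)) *v y))" for y
    using a by (simp add: shift_apply M matrix_vector_mult_diff_distrib vector_ssub_ldistrib
        vector_scalar_commute vector_smult_assoc)
  then have "shift_pow M \<mu> m (S *v x) = inverse a ^ m *s (S *v shift_pow B (a * \<mu>) m x)"
    by (induct m) (simp_all add: vector_scalar_commute vector_smult_assoc mult.commute)
  then show ?thesis unfolding gen_eigenvector_def using a inj by simp
qed

text \<open>With the projection \<open>P = v w^T\<close>, the last assumption reads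
  \<open>D = (I - P) B + d P\<close>: a Wielandt deflation that trades the eigenvalue
  \<open>a\<close> of \<open>B\<close> at \<open>v\<close> for \<open>d\<close>.\<close>

locale deflation =
  fixes B D :: "complex^'n::finite^'n" and v w :: "complex^'n" and a d :: complex
  assumes wv: "(\<Sum>i\<in>UNIV. w $ i * v $ i) = 1"
    and Bv: "B *v v = a *s v"
    and D: "D *v x = B *v x - ((\<Sum>i\<in>UNIV. w $ i * (B *v x) $ i) - d * (\<Sum>i\<in>UNIV. w $ i * x $ i)) *s v"
begin

definition coeff :: "complex^'n \<Rightarrow> complex" where
  "coeff x = (\<Sum>i\<in>UNIV. w $ i * x $ i)"

text \<open>The projection \<open>I - P\<close> onto the kernel of \<open>coeff\<close> along
  \<open>v\<close>.\<close>

definition proj :: "complex^'n \<Rightarrow> complex^'n" where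
  "proj x = x - coeff x *s v"

lemma coeff_simps [simp]:
  "coeff (x + y) = coeff x + coeff y" "coeff (x - y) = coeff x - coeff y"
  "coeff (b *s x) = b * coeff x" "coeff 0 = 0" "coeff v = 1"
  using wv by (simp_all add: coeff_def algebra_simps sum.distrib sum_subtractf sum_distrib_left)

lemma v_nonzero: "v \<noteq> 0"
  using coeff_simps(4,5) by fastforce

lemma D_apply: "D *v x = B *v x - (coeff (B *v x) - d * coeff x) *s v"
  using D[of x] by (simp add: coeff_def)

lemma D_v: "D *v v = d *s v"
  by (simp add: D_apply Bv vector_sub_rdistrib)

lemma coeff_D: "coeff (D *v x) = d * coeff x"
  by (simp add: D_apply)

lemma proj_simps: "proj (x - y) = proj x - proj y" "proj (b *s x) = b *s proj x" "proj v = 0"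
  by (simp_all add: proj_def vector_sub_rdistrib vector_ssub_ldistrib vector_smult_assoc)

lemma coeff_proj: "coeff (proj x) = 0"
  by (simp add: proj_def)

lemma proj_eq_0_iff: "proj x = 0 \<longleftrightarrow> (\<exists>b. x = b *s v)"
  by (metis eq_iff_diff_eq_0 proj_def proj_simps(2,3) vector_smult_rzero)

text \<open>The intertwining relation on which the eigenvector correspondence rests.
  \<open>B\<close> preserves the line through \<open>v\<close>, so the \<open>v\<close> component
  may be dropped before applying \<open>B\<close> and projecting; on the kernel of
  \<open>coeff\<close>, \<open>D\<close> is \<open>B\<close> followed by
  \<open>proj\<close>.\<close>

lemma D_proj: "D *v proj x = proj (B *v x)"
proof -
  have "B *v proj x = B *v x - (coeff x * a) *s v"
    by (simp add: proj_def matrix_vector_mult_diff_distrib vector_scalar_commute Bv vector_smult_assoc)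
  then have "proj (B *v proj x) = proj (B *v x)" by (simp add: proj_simps)
  moreover have "D *v proj x = proj (B *v proj x)"
    by (simp add: D_apply coeff_proj) (simp add: proj_def)
  ultimately show ?thesis by simp
qed

lemma proj_shift_pow: "shift_pow D \<nu> m (proj x) = proj (shift_pow B \<nu> m x)"
  by (induct m) (simp_all add: shift_apply D_proj proj_simps)

text \<open>\<open>coeff\<close> is a left eigenvector of \<open>D\<close> for \<open>d\<close>, so
  a generalized eigenvector can have a \<open>v\<close> component only when its eigenvalue is
  \<open>d\<close>.\<close>

lemma coeff_shift_pow: "coeff (shift_pow D \<nu> m x) = (d - \<nu>) ^ m * coeff x"
  by (induct m) (simp_all add: shift_apply coeff_D left_diff_distrib)

lemma gen_eigenvector_proj:
  assumes "gen_eigenvector B \<nu> m u" "\<nexists>b. u = b *s v"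
  shows "gen_eigenvector D \<nu> m (proj u)"
  using assms by (simp add: gen_eigenvector_def proj_shift_pow proj_eq_0_iff)

text \<open>A preimage of \<open>proj V\<close> lies in the generalized eigenspace of \<open>B\<close> after a correction by a
  multiple of \<open>v\<close>, which exists unless \<open>\<nu> = a\<close>; in that case the order goes up by one instead.\<close>

lemma gen_eigenvector_deflated_cases:
  assumes V: "gen_eigenvector D \<nu> m V"
  shows "\<exists>b u. V = b *s v + proj u \<and> (b \<noteq> 0 \<longrightarrow> \<nu> = d) \<and>
    (u \<noteq> 0 \<longrightarrow> (\<nexists>b. u = b *s v) \<and> (\<exists>m'. (\<nu> \<noteq> a \<longrightarrow> m' = m) \<and> gen_eigenvector B \<nu> m' u))"
proof -
  have m: "m \<ge> 1" and DV: "shift_pow D \<nu> m V = 0" using V by (auto simp: gen_eigenvector_def)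
  have split: "V = coeff V *s v + proj V" by (simp add: proj_def)
  have "(d - \<nu>) ^ m * coeff V = 0" using coeff_shift_pow[where \<nu> = \<nu> and m = m and x = V] DV by simp
  then have b: "coeff V \<noteq> 0 \<longrightarrow> \<nu> = d" by auto
  have "shift_pow D \<nu> m (coeff V *s v) = coeff V *s ((d - \<nu>) ^ m *s v)"
    by (simp only: shift_pow_scale shift_pow_eigenvector[OF D_v])
  also have "\<dots> = 0" using \<open>(d - \<nu>) ^ m * coeff V = 0\<close> by (auto simp: vector_smult_assoc mult.commute)
  finally have "shift_pow D \<nu> m (proj V) = 0" unfolding proj_def shift_pow_diff using DV by simp
  \<comment> \<open>By the intertwining relation, \<open>V\<close> fails to be a generalized
    eigenvector of \<open>B\<close> only by a multiple of \<open>v\<close>.\<close>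
  then have "proj (shift_pow B \<nu> m V) = 0" by (simp only: proj_shift_pow)
  then obtain t where t: "shift_pow B \<nu> m V = t *s v" unfolding proj_eq_0_iff by blast
  show ?thesis
  proof (cases "proj V = 0")
    case True
    then show ?thesis using split b proj_simps(2)[of 0] by (intro exI[of _ "coeff V"] exI[of _ 0]) simp
  next
    case False
    show ?thesis
    proof (cases "\<nu> = a")
      case True
      have "shift_pow B \<nu> (Suc m) V = 0"
        using t True by (simp add: shift_apply vector_scalar_commute Bv)
      then have "gen_eigenvector B \<nu> (Suc m) V" using V by (simp add: gen_eigenvector_def)
      then show ?thesis using split b True False proj_eq_0_iff
        by (intro exI[of _ "coeff V"] exI[of _ V]) auto
    next
      case ne: False
      \<comment> \<open>The shifted power multiplies \<open>v\<close> by
        \<open>(a - \<nu>) ^ m\<close>, so this correction cancels \<open>t *s v\<close>.\<close>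
      define u where "u = V - (t / (a - \<nu>) ^ m) *s v"
      have pu: "proj u = proj V" by (simp add: u_def proj_simps)
      then have nu: "\<nexists>b. u = b *s v" using False proj_eq_0_iff by metis
      moreover have "shift_pow B \<nu> m u = 0"
        using ne by (simp add: u_def shift_pow_diff shift_pow_scale shift_pow_eigenvector[OF Bv] t
            vector_smult_assoc)
      moreover have "u \<noteq> 0" using nu by (metis vector_smult_lzero)
      ultimately have "gen_eigenvector B \<nu> m u" using m by (simp add: gen_eigenvector_def)
      then show ?thesis using split b nu pu
        by (intro exI[of _ "coeff V"] exI[of _ u]) auto
    qed
  qed
qed

text \<open>The hypothesis only places \<open>shift_pow B \<nu> m u\<close> on the line through
  \<open>v\<close>. Since \<open>B - a I\<close> kills that line and commutes with the shifted
  power, applying it to \<open>u\<close> gives a genuine kernel element. This element vanishes only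
  if \<open>u\<close> is itself an eigenvector for \<open>a\<close>, the second alternative.\<close>

lemma gen_eigenvector_shift:
  assumes "gen_eigenvector D \<nu> m (proj u)"
  shows "gen_eigenvector B \<nu> m ((B - scalar_mat a) *v u) \<or>
    \<nu> = a \<and> (B - scalar_mat a) *v u = 0 \<and> gen_eigenvector B a 1 u"
proof -
  have m: "m \<ge> 1" and ne: "proj u \<noteq> 0" and "proj (shift_pow B \<nu> m u) = 0"
    using assms by (auto simp: gen_eigenvector_def proj_shift_pow)
  then obtain t where t: "shift_pow B \<nu> m u = t *s v" unfolding proj_eq_0_iff by blast
  have ker: "shift_pow B \<nu> m ((B - scalar_mat a) *v u) = 0"
    unfolding shift_pow_commute[symmetric] t by (simp add: shift_apply vector_scalar_commute Bv)
  show ?thesis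
  proof (cases "(B - scalar_mat a) *v u = 0")
    case True
    then have Bu: "B *v u = a *s u" by (simp add: shift_apply)
    have "(a - \<nu>) ^ m *s proj u = 0"
      using t shift_pow_eigenvector[OF Bu, where \<nu> = \<nu> and m = m] by (metis proj_simps(2,3) vector_smult_rzero)
    then have "\<nu> = a" using ne by auto
    moreover have "u \<noteq> 0" using ne by (auto simp: proj_def)
    ultimately show ?thesis using True by (simp add: gen_eigenvector_def)
  qed (use m ker in \<open>simp add: gen_eigenvector_def\<close>)
qed

text \<open>\<open>B - a I\<close> is invertible on the kernel of each power of
  \<open>B - \<nu> I\<close>. The induction writes \<open>(a - \<nu>) x\<close> as
  \<open>(B - \<nu> I) x\<close>, which has lower order, minus \<open>(B - a I) x\<close>.\<close>

lemma shift_surj_on_kernel: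
  assumes "\<nu> \<noteq> a" "shift_pow B \<nu> m x = 0"
  shows "\<exists>u. shift_pow B \<nu> m u = 0 \<and> (B - scalar_mat a) *v u = x"
  using assms(2)
proof (induct m arbitrary: x)
  case 0
  then show ?case by (intro exI[of _ 0]) simp
next
  case (Suc m)
  have "shift_pow B \<nu> m ((B - scalar_mat \<nu>) *v x) = 0"
    using Suc.prems by (simp add: shift_pow_commute)
  then obtain t where t: "shift_pow B \<nu> m t = 0" "(B - scalar_mat a) *v t = (B - scalar_mat \<nu>) *v x"
    using Suc.hyps by blast
  define u where "u = inverse (a - \<nu>) *s (t - x)"
  have "shift_pow B \<nu> (Suc m) (t - x) = shift_pow B \<nu> (Suc m) t - shift_pow B \<nu> (Suc m) x"
    by (rule shift_pow_diff)
  also have "\<dots> = 0" using t(1) Suc.prems by simp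
  finally have "shift_pow B \<nu> (Suc m) u = 0"
    unfolding u_def shift_pow_scale by simp
  moreover have "(B - scalar_mat a) *v (t - x) = (a - \<nu>) *s x"
    using t(2) by (simp add: matrix_vector_mult_diff_distrib)
      (simp add: shift_apply vector_sub_rdistrib)
  then have "(B - scalar_mat a) *v u = x"
    using assms(1) unfolding u_def vector_scalar_commute by (simp add: vector_smult_assoc del: vector_sub_rdistrib)
  ultimately show ?case by blast
qed

lemma gen_eigenvector_shift_preimage:
  assumes "\<nu> \<noteq> a" "gen_eigenvector B \<nu> m x"
  shows "\<exists>u. gen_eigenvector D \<nu> m (proj u) \<and> x = (B - scalar_mat a) *v u"
proof -
  obtain u where u: "shift_pow B \<nu> m u = 0" "(B - scalar_mat a) *v u = x"
    using shift_surj_on_kernel[OF assms(1)] assms(2) unfolding gen_eigenvector_def by blast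
  have "x \<noteq> 0" "m \<ge> 1" using assms(2) by (auto simp: gen_eigenvector_def)
  \<comment> \<open>A multiple of \<open>v\<close> would be annihilated by \<open>B - a I\<close>,
    but \<open>x\<close> is nonzero.\<close>
  have "\<nexists>b. u = b *s v"
    using u(2) \<open>x \<noteq> 0\<close> by (auto simp: shift_apply vector_scalar_commute Bv vector_smult_assoc mult.commute)
  moreover from this have "u \<noteq> 0" by (metis vector_smult_lzero)
  ultimately have "gen_eigenvector D \<nu> m (proj u)"
    using u(1) \<open>m \<ge> 1\<close> by (intro gen_eigenvector_proj) (auto simp: gen_eigenvector_def)
  then show ?thesis using u(2) by blast
qed

end

section \<open>Calculus of the compactification\<close>

lemma diag_mult_vec [simp]: "(diag a *v x) $ i = a i * (x :: 'a::semiring_1^'n::finite) $ i"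
  by (simp add: diag_def matrix_vector_mult_def if_distrib[of "\<lambda>y. y * x $ j" for j] cong: if_cong)

lemma Lam_mult_vec: "(Lam \<alpha> *v x) $ i = real (\<alpha> i) * x $ i"
  by (simp add: Lam_def)

lemma spow_mult_vec: "(spow \<alpha> s *v x) $ i = s ^ \<alpha> i * x $ i"
  by (simp add: spow_def)

lemma c_pos: "c \<alpha> > 0"
proof -
  have "c \<alpha> \<noteq> 0" unfolding c_def by (subst Lcm_0_iff) (auto simp: J_def)
  then show ?thesis by simp
qed

lemma \<beta>_mult: "i \<in> J \<alpha> \<Longrightarrow> \<beta> \<alpha> i * \<alpha> i = c \<alpha>"
  unfolding \<beta>_def c_def by (simp add: dvd_Lcm)

lemma \<beta>_pos: "i \<in> J \<alpha> \<Longrightarrow> \<beta> \<alpha> i > 0"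
  using \<beta>_mult[of i \<alpha>] c_pos[of \<alpha>] by (metis gr0I less_not_refl mult_zero_left)

text \<open>The polynomial \<open>p ^ (2 c)\<close>, free of the root in \<open>p\<close>, on which
  the calculus is carried out.\<close>

definition q :: "('n::finite \<Rightarrow> nat) \<Rightarrow> real^'n \<Rightarrow> real" where
  "q \<alpha> x = (\<Sum>i\<in>J \<alpha>. (x $ i) ^ (2 * \<beta> \<alpha> i))"

text \<open>The gradient of \<open>q\<close> divided by \<open>2 c\<close>. With this normalization
  it agrees with the gradient of \<open>p\<close> on the horizon, and its pairing with
  \<open>ftilde\<close> is \<open>G\<close>.\<close>

definition grad_q :: "('n::finite \<Rightarrow> nat) \<Rightarrow> real^'n \<Rightarrow> real^'n" where
  "grad_q \<alpha> x = (\<chi> j. if j \<in> J \<alpha> then (x $ j) ^ (2 * \<beta> \<alpha> j - 1) / real (\<alpha> j) else 0)"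

definition Dgrad_q :: "('n::finite \<Rightarrow> nat) \<Rightarrow> real^'n \<Rightarrow> real^'n \<Rightarrow> real^'n" where
  "Dgrad_q \<alpha> x h = (\<chi> j. if j \<in> J \<alpha> then
     real (2 * \<beta> \<alpha> j - 1) * x $ j ^ (2 * \<beta> \<alpha> j - 2) / real (\<alpha> j) * h $ j else 0)"

lemma q_nonneg: "q \<alpha> x \<ge> 0"
  unfolding q_def by (intro sum_nonneg zero_le_even_power) simp

lemma p_nonneg: "p \<alpha> x \<ge> 0"
  unfolding p_def by simp

lemma p_power: "p \<alpha> x ^ (2 * c \<alpha>) = q \<alpha> x"
proof (cases "q \<alpha> x = 0")
  case True
  then show ?thesis unfolding p_def using c_pos[of \<alpha>] by (simp add: q_def power_0_left)
next
  case False
  then have "q \<alpha> x > 0" using q_nonneg[of \<alpha> x] by simp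
  then have "p \<alpha> x ^ (2 * c \<alpha>) = (q \<alpha> x powr (1 / (2 * real (c \<alpha>)))) powr real (2 * c \<alpha>)"
    by (subst powr_realpow) (simp_all add: p_def q_def)
  then show ?thesis using \<open>q \<alpha> x > 0\<close> c_pos[of \<alpha>] by (simp add: powr_powr)
qed

lemma mem_\<D>_iff: "x \<in> \<D> \<alpha> \<longleftrightarrow> q \<alpha> x < 1"
  unfolding p_power[symmetric] \<D>_def
  using power_less_one_iff[OF p_nonneg[of \<alpha> x], where n = "2 * c \<alpha>"] c_pos[of \<alpha>] by simp

lemma mem_horizon_iff: "x \<in> horizon \<alpha> \<longleftrightarrow> q \<alpha> x = 1"
  unfolding p_power[symmetric] horizon_def
  using power_eq_iff_eq_base[of "2 * c \<alpha>" "p \<alpha> x" 1] p_nonneg[of \<alpha> x] c_pos[of \<alpha>] by simp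

lemma \<kappa>_eq: "\<kappa> \<alpha> x = 1 / (1 - q \<alpha> x)"
  unfolding \<kappa>_def p_power ..

lemma \<kappa>_pos: "x \<in> \<D> \<alpha> \<Longrightarrow> \<kappa> \<alpha> x > 0"
  unfolding \<kappa>_eq mem_\<D>_iff by simp

lemma q_has_derivative:
  "(q \<alpha> has_derivative (\<lambda>h. 2 * real (c \<alpha>) * (grad_q \<alpha> x \<bullet> h))) (at x)"
proof -
  have "((\<lambda>x. x $ i ^ (2 * \<beta> \<alpha> i)) has_derivative
      (\<lambda>h. 2 * real (c \<alpha>) * (x $ i ^ (2 * \<beta> \<alpha> i - 1) / real (\<alpha> i)) * h $ i)) (at x)"
    if i: "i \<in> J \<alpha>" for i
  proof -
    have "real (c \<alpha>) = real (\<beta> \<alpha> i) * real (\<alpha> i)" using \<beta>_mult[OF i] by (simp flip: of_nat_mult)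
    then have "2 * real (c \<alpha>) * (x $ i ^ (2 * \<beta> \<alpha> i - 1) / real (\<alpha> i)) =
        real (2 * \<beta> \<alpha> i) * x $ i ^ (2 * \<beta> \<alpha> i - 1)"
      using i by (simp add: J_def)
    then show ?thesis
      by (auto intro!: derivative_eq_intros bounded_linear.has_derivative[OF bounded_linear_vec_nth] simp: mult_ac)
  qed
  then have "(q \<alpha> has_derivative (\<lambda>h. \<Sum>i\<in>J \<alpha>. 2 * real (c \<alpha>) * (x $ i ^ (2 * \<beta> \<alpha> i - 1) / real (\<alpha> i)) * h $ i)) (at x)"
    unfolding q_def by (intro has_derivative_sum) auto
  moreover have "grad_q \<alpha> x \<bullet> h = (\<Sum>i\<in>J \<alpha>. x $ i ^ (2 * \<beta> \<alpha> i - 1) / real (\<alpha> i) * h $ i)" for h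
    unfolding inner_vec_def grad_q_def
    by (rule sum.mono_neutral_cong_right) auto
  ultimately show ?thesis by (simp add: sum_distrib_left mult.assoc)
qed

lemma continuous_q: "continuous_on S (q \<alpha>)"
  by (intro continuous_at_imp_continuous_on ballI has_derivative_continuous[OF q_has_derivative])

lemma open_\<D>: "open (\<D> \<alpha>)"
proof -
  have "\<D> \<alpha> = {x. q \<alpha> x < 1}" by (auto simp: mem_\<D>_iff)
  then show ?thesis using open_Collect_less[OF continuous_q continuous_on_const] by simp
qed

lemma grad_q_has_derivative:
  fixes \<alpha> :: "'n::finite \<Rightarrow> nat"
  shows "(grad_q \<alpha> has_derivative Dgrad_q \<alpha> x) (at x)"
proof (subst has_derivative_componentwise_within, rule ballI)
  fix b :: "real^'n" assume "b \<in> Basis"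
  then obtain j where b: "b = axis j 1" by (auto simp: Basis_vec_def)
  have "((\<lambda>x. x $ j ^ (2 * \<beta> \<alpha> j - 1) * inverse (real (\<alpha> j))) has_derivative
     (\<lambda>h. real (2 * \<beta> \<alpha> j - 1) * h $ j * x $ j ^ (2 * \<beta> \<alpha> j - 1 - 1) * inverse (real (\<alpha> j)))) (at x)"
    by (intro has_derivative_mult_left has_derivative_power
        bounded_linear.has_derivative[OF bounded_linear_vec_nth] has_derivative_ident)
  then have "((\<lambda>x. x $ j ^ (2 * \<beta> \<alpha> j - 1) / real (\<alpha> j)) has_derivative
     (\<lambda>h. real (2 * \<beta> \<alpha> j - 1) * x $ j ^ (2 * \<beta> \<alpha> j - 2) / real (\<alpha> j) * h $ j)) (at x)"
    by (simp add: field_class.field_divide_inverse numeral_2_eq_2 mult_ac)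
  then show "((\<lambda>x. grad_q \<alpha> x \<bullet> b) has_derivative (\<lambda>h. Dgrad_q \<alpha> x h \<bullet> b)) (at x)"
    by (cases "j \<in> J \<alpha>") (simp_all add: b inner_axis grad_q_def Dgrad_q_def)
qed

text \<open>Chain rule for the \<open>2 c\<close>-th root of \<open>q\<close>, whose outer
  derivative at \<open>q = 1\<close> is \<open>1 / (2 c)\<close>.\<close>

lemma grad_p_eq:
  assumes "x \<in> horizon \<alpha>"
  shows "grad_p \<alpha> x = grad_q \<alpha> x"
proof -
  have q1: "q \<alpha> x = 1" using assms mem_horizon_iff by blast
  have "(p \<alpha> has_derivative (\<lambda>h. grad_q \<alpha> x \<bullet> h)) (at x)"
  proof -
    have "((\<lambda>x. q \<alpha> x powr (1 / (2 * real (c \<alpha>)))) has_derivative (\<lambda>h. grad_q \<alpha> x \<bullet> h)) (at x)"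
      using c_pos[of \<alpha>] by (auto intro!: derivative_eq_intros q_has_derivative simp: q1)
    then show ?thesis by (simp add: p_def[abs_def] q_def)
  qed
  then have "frechet_derivative (p \<alpha>) (at x) = (\<lambda>h. grad_q \<alpha> x \<bullet> h)"
    by (rule frechet_derivative_at[symmetric])
  then show ?thesis by (simp add: grad_p_def Finite_Cartesian_Product.vec_eq_iff inner_axis)
qed

text \<open>Euler's identity for \<open>q\<close>: the weights cancel and the sum is
  \<open>q\<close> itself. This is what makes \<open>P\<close> in the theorem a projection.\<close>

lemma grad_q_Lam:
  assumes "x \<in> horizon \<alpha>"
  shows "grad_q \<alpha> x \<bullet> (Lam \<alpha> *v x) = 1"
proof -
  have "grad_q \<alpha> x \<bullet> (Lam \<alpha> *v x) = (\<Sum>i\<in>J \<alpha>. x $ i ^ (2 * \<beta> \<alpha> i - 1) / real (\<alpha> i) * (real (\<alpha> i) * x $ i))"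
    unfolding inner_vec_def grad_q_def
    by (rule sum.mono_neutral_cong_right) (auto simp: Lam_mult_vec)
  also have "\<dots> = q \<alpha> x" unfolding q_def
  proof (rule sum.cong[OF refl])
    fix i assume i: "i \<in> J \<alpha>"
    have "x $ i ^ (2 * \<beta> \<alpha> i - 1) * x $ i = x $ i ^ (2 * \<beta> \<alpha> i)"
      using \<beta>_pos[OF i] by (simp flip: power_Suc2)
    then show "x $ i ^ (2 * \<beta> \<alpha> i - 1) / real (\<alpha> i) * (real (\<alpha> i) * x $ i) = x $ i ^ (2 * \<beta> \<alpha> i)"
      using i by (simp add: J_def)
  qed
  finally show ?thesis using assms by (simp add: mem_horizon_iff)
qed

text \<open>Since \<open>\<alpha>\<^sub>j \<beta>\<^sub>j = c\<close>, testing against \<open>\<Lambda> x\<close> makes the leading coefficient independent of \<open>j\<close>.\<close>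

lemma Dgrad_q_Lam:
  "Dgrad_q \<alpha> x h \<bullet> (Lam \<alpha> *v x) = 2 * real (c \<alpha>) * (grad_q \<alpha> x \<bullet> h) - grad_q \<alpha> x \<bullet> (Lam \<alpha> *v h)"
  unfolding inner_vec_def sum_distrib_left sum_subtractf[symmetric]
proof (rule sum.cong[OF refl])
  fix j
  show "Dgrad_q \<alpha> x h $ j \<bullet> (Lam \<alpha> *v x) $ j =
    2 * real (c \<alpha>) * (grad_q \<alpha> x $ j \<bullet> h $ j) - grad_q \<alpha> x $ j \<bullet> (Lam \<alpha> *v h) $ j"
  proof (cases "j \<in> J \<alpha>")
    case True
    obtain b where b: "\<beta> \<alpha> j = Suc b" using \<beta>_pos[OF True] gr0_implies_Suc by blast
    have "real (c \<alpha>) = real (\<beta> \<alpha> j) * real (\<alpha> j)" using \<beta>_mult[OF True] by (simp flip: of_nat_mult)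
    then show ?thesis using True
      by (simp add: grad_q_def Dgrad_q_def Lam_mult_vec b) (simp add: J_def field_simps)
  qed (simp add: grad_q_def Dgrad_q_def)
qed

section \<open>Approach to the horizon from inside the domain\<close>

lemma horizon_nonzero: "x \<in> horizon \<alpha> \<Longrightarrow> x \<noteq> 0"
  using \<beta>_pos[of _ \<alpha>] by (auto simp: mem_horizon_iff q_def power_0_left)

text \<open>Shrinking \<open>x\<close> towards the origin enters the domain because every exponent
  \<open>2 * \<beta> \<alpha> i\<close> is at least \<open>2\<close>. Nontriviality of the filter
  makes the limit in \<open>horizon_jacobian\<close> unique.\<close>

lemma horizon_islimpt_\<D>:
  assumes x: "x \<in> horizon \<alpha>"
  shows "x islimpt \<D> \<alpha>"
proof -
  \<comment> \<open>The shift by \<open>2\<close> keeps \<open>t 0\<close> positive.\<close>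
  define t where "t n = 1 - 1 / real (n + 2)" for n
  have t: "0 < t n" "t n < 1" for n by (simp_all add: t_def field_simps)
  have le: "q \<alpha> (t n *\<^sub>R x) \<le> t n ^ 2 * q \<alpha> x" for n
    unfolding q_def sum_distrib_left
  proof (rule sum_mono)
    fix i assume i: "i \<in> J \<alpha>"
    have "t n ^ (2 * \<beta> \<alpha> i) \<le> t n ^ 2"
      using \<beta>_pos[OF i] t[of n] by (intro power_decreasing) auto
    then show "(t n *\<^sub>R x) $ i ^ (2 * \<beta> \<alpha> i) \<le> t n ^ 2 * x $ i ^ (2 * \<beta> \<alpha> i)"
      by (simp add: power_mult_distrib mult_right_mono)
  qed
  have inD: "t n *\<^sub>R x \<in> \<D> \<alpha>" for n
    using le[of n] x power_less_one_iff[of "t n" 2] t[of n]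
    unfolding mem_\<D>_iff mem_horizon_iff by simp
  have "t n *\<^sub>R x \<noteq> x" for n
    using horizon_nonzero[OF x] t(2)[of n] scaleR_cancel_right[of "t n" x 1] by simp
  moreover have "(\<lambda>n. t n *\<^sub>R x) \<longlonglongrightarrow> 1 *\<^sub>R x"
  proof (rule tendsto_scaleR[OF _ tendsto_const])
    have "(\<lambda>n. 1 / real (n + 2)) \<longlonglongrightarrow> 0"
      by (rule LIMSEQ_ignore_initial_segment[OF lim_1_over_n])
    then have "(\<lambda>n. 1 - 1 / real (n + 2)) \<longlonglongrightarrow> 1 - 0" by (intro tendsto_diff tendsto_const)
    then show "t \<longlonglongrightarrow> 1" by (simp add: t_def[abs_def])
  qed
  ultimately have "\<exists>f. (\<forall>n. f n \<in> \<D> \<alpha> - {x}) \<and> f \<longlonglongrightarrow> x"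
    using inD by (intro exI[of _ "\<lambda>n. t n *\<^sub>R x"] conjI allI DiffI)
      (simp_all only: scaleR_one singleton_iff not_False_eq_True)
  then show ?thesis by (simp only: islimpt_sequential)
qed

lemma horizon_nontrivial: "x \<in> horizon \<alpha> \<Longrightarrow> at x within \<D> \<alpha> \<noteq> bot"
  using horizon_islimpt_\<D> trivial_limit_within by blast

section \<open>The Jacobian of the desingularized field on the horizon\<close>

lemma G_eq: "G \<alpha> k f F x = grad_q \<alpha> x \<bullet> ftilde \<alpha> k f F x"
  unfolding G_def inner_vec_def grad_q_def
  by (rule sum.mono_neutral_cong_left) auto

lemma has_derivative_vec_nthI:
  fixes f :: "'a::euclidean_space \<Rightarrow> real^'n"
  assumes "\<And>j. ((\<lambda>x. f x $ j) has_derivative (\<lambda>h. f' h $ j)) (at x within S)"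
  shows "(f has_derivative f') (at x within S)"
proof (subst has_derivative_componentwise_within, rule ballI)
  fix b :: "real^'n" assume "b \<in> Basis"
  then obtain j where b: "b = axis j 1" by (auto simp: Basis_vec_def)
  show "((\<lambda>x. f x \<bullet> b) has_derivative (\<lambda>h. f' h \<bullet> b)) (at x within S)"
    using assms[of j] by (simp add: b inner_axis)
qed

lemma differentiable_vec_nthI:
  fixes f :: "'a::euclidean_space \<Rightarrow> real^'n"
  assumes "\<And>j. (\<lambda>x. f x $ j) differentiable (at x within S)"
  shows "f differentiable (at x within S)"
proof (subst differentiable_componentwise_within, rule ballI)
  fix b :: "real^'n" assume "b \<in> Basis"
  then obtain j where b: "b = axis j 1" by (auto simp: Basis_vec_def)
  show "(\<lambda>x. f x \<bullet> b) differentiable (at x within S)"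
    using assms[of j] by (simp add: b inner_axis)
qed

lemma jacobian_mult_vec:
  fixes f :: "real^'n::finite \<Rightarrow> real^'m::finite"
  shows "f differentiable (at x) \<Longrightarrow> jacobian f (at x) *v h = frechet_derivative f (at x) h"
  using fun_cong[OF frechet_derivative_at[OF jacobian_works[THEN iffD1]]] .

lemma jacobian_nth: "jacobian f net $ i $ l = frechet_derivative f net (axis l 1) $ i"
  by (simp add: jacobian_def matrix_def)

lemma horizon_jacobian_nth:
  fixes h L :: "real^'n::finite \<Rightarrow> real^'n"
  assumes x: "x \<in> horizon \<alpha>"
    and lim: "\<And>l. ((\<lambda>y. frechet_derivative h (at y) (axis l 1)) \<longlongrightarrow> L (axis l 1)) (at x within \<D> \<alpha>)"
  shows "horizon_jacobian \<alpha> h x $ i $ l = L (axis l 1) $ i"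
proof -
  have "((\<lambda>y. jacobian h (at y)) \<longlongrightarrow> matrix L) (at x within \<D> \<alpha>)"
    by (intro vec_tendstoI) (simp add: jacobian_nth matrix_def tendsto_vec_nth[OF lim])
  then have "horizon_jacobian \<alpha> h x = matrix L"
    unfolding horizon_jacobian_def by (rule tendsto_Lim[OF horizon_nontrivial[OF x]])
  then show ?thesis by (simp add: matrix_def)
qed

text \<open>\<open>Lam \<alpha>\<close> is the infinitesimal generator of the scaling group;
  differentiating a scaling relation at \<open>1\<close> yields Euler's identity.\<close>

lemma spow_has_derivative_at_1:
  "((\<lambda>s. spow \<alpha> s *v x) has_derivative (\<lambda>h. h *\<^sub>R (Lam \<alpha> *v x))) (at 1)"
proof (rule has_derivative_vec_nthI)
  fix j
  have "((\<lambda>s. s ^ \<alpha> j * x $ j) has_derivative (\<lambda>h. real (\<alpha> j) * h * 1 ^ (\<alpha> j - 1) * x $ j)) (at 1)"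
    by (intro has_derivative_mult_left has_derivative_power has_derivative_ident)
  then show "((\<lambda>s. (spow \<alpha> s *v x) $ j) has_derivative (\<lambda>h. (h *\<^sub>R (Lam \<alpha> *v x)) $ j)) (at 1)"
    by (simp add: spow_mult_vec Lam_mult_vec mult_ac)
qed

section \<open>The scaling group and its effect on \<open>p\<close>\<close>

lemma spow_spow: "spow \<alpha> s *v (spow \<alpha> t *v x) = spow \<alpha> (s * t) *v x"
  by (simp add: Finite_Cartesian_Product.vec_eq_iff spow_mult_vec power_mult_distrib)

lemma spow_one: "spow \<alpha> 1 *v x = x"
  by (simp add: Finite_Cartesian_Product.vec_eq_iff spow_mult_vec)

lemma q_spow: "q \<alpha> (spow \<alpha> s *v x) = s ^ (2 * c \<alpha>) * q \<alpha> x"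
  unfolding q_def sum_distrib_left
proof (rule sum.cong[OF refl])
  fix i assume i: "i \<in> J \<alpha>"
  have "(s ^ \<alpha> i) ^ (2 * \<beta> \<alpha> i) = s ^ (2 * c \<alpha>)"
    by (metis \<beta>_mult[OF i] mult.commute mult.left_commute power_mult)
  then show "(spow \<alpha> s *v x) $ i ^ (2 * \<beta> \<alpha> i) = s ^ (2 * c \<alpha>) * x $ i ^ (2 * \<beta> \<alpha> i)"
    by (simp add: spow_mult_vec power_mult_distrib)
qed

text \<open>\<open>p\<close> has degree one under the scaling. This identifies the radii
  \<open>rY\<close> and \<open>rx\<close>.\<close>

lemma p_spow_horizon:
  assumes "x \<in> horizon \<alpha>" "s > 0"
  shows "p \<alpha> (spow \<alpha> s *v x) = s"
proof -
  have "p \<alpha> (spow \<alpha> s *v x) ^ (2 * c \<alpha>) = s ^ (2 * c \<alpha>)"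
    using assms by (simp add: p_power q_spow mem_horizon_iff)
  then show ?thesis
    using power_eq_iff_eq_base[of "2 * c \<alpha>" "p \<alpha> (spow \<alpha> s *v x)" s] p_nonneg[of \<alpha> "spow \<alpha> s *v x"]
      assms(2) c_pos[of \<alpha>] by simp
qed

lemma q_tendsto_horizon:
  assumes "x \<in> horizon \<alpha>"
  shows "(q \<alpha> \<longlongrightarrow> 1) (at x within S)"
proof -
  have "isCont (q \<alpha>) x" by (rule has_derivative_continuous[OF q_has_derivative])
  then have "(q \<alpha> \<longlongrightarrow> q \<alpha> x) (at x within S)"
    unfolding isCont_def by (rule filterlim_mono) (simp_all add: at_le)
  then show ?thesis using assms by (simp add: mem_horizon_iff)
qed

lemma eventually_at_\<D>: "(\<And>y. y \<in> \<D> \<alpha> \<Longrightarrow> P y) \<Longrightarrow> eventually P (at x within \<D> \<alpha>)"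
  by (auto simp: eventually_at_filter)

lemma \<kappa>_powr_smallo:
  assumes x: "x \<in> horizon \<alpha>" and e: "e > 0"
  shows "(\<lambda>y. \<kappa> \<alpha> y powr (- e)) \<in> o[at x within \<D> \<alpha>](\<lambda>_. 1)"
proof -
  have "((\<lambda>y. (1 - q \<alpha> y) powr e) \<longlongrightarrow> 0 powr e) (at x within \<D> \<alpha>)"
  proof (rule tendsto_powr')
    show "((\<lambda>y. 1 - q \<alpha> y) \<longlongrightarrow> 0) (at x within \<D> \<alpha>)"
      using tendsto_diff[OF tendsto_const q_tendsto_horizon[OF x], of 1 "\<D> \<alpha>"] by simp
    show "0 \<noteq> (0::real) \<or> 0 < e \<and> (\<forall>\<^sub>F y in at x within \<D> \<alpha>. 0 \<le> 1 - q \<alpha> y)"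
      using e by (auto intro!: eventually_at_\<D> simp: mem_\<D>_iff)
  qed (rule tendsto_const)
  then have "((\<lambda>y. (1 - q \<alpha> y) powr e) \<longlongrightarrow> 0) (at x within \<D> \<alpha>)" by simp
  then have "((\<lambda>y. \<kappa> \<alpha> y powr (- e)) \<longlongrightarrow> 0) (at x within \<D> \<alpha>)"
    by (rule Lim_transform_eventually)
      (rule eventually_at_\<D>, simp add: \<kappa>_eq mem_\<D>_iff powr_minus powr_divide)
  then show ?thesis by (intro smalloI_tendsto) auto
qed

lemma rescale_differentiable:
  assumes h: "\<And>x. h differentiable (at x)" and y: "y \<in> \<D> \<alpha>"
  shows "rescale \<alpha> k h differentiable (at y)"
proof -
  have "q \<alpha> differentiable (at y)" using q_has_derivative differentiableI by blast
  then have k_diff: "\<kappa> \<alpha> differentiable (at y)"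
    using y unfolding \<kappa>_eq[abs_def] by (intro derivative_intros) (auto simp: mem_\<D>_iff)
  have sp: "(\<lambda>y. spow \<alpha> (\<kappa> \<alpha> y) *v y) differentiable (at y)"
  proof (rule differentiable_vec_nthI)
    fix j
    have "(\<lambda>y. y $ j) differentiable (at y)"
      using bounded_linear.has_derivative[OF bounded_linear_vec_nth has_derivative_ident] differentiableI by blast
    then show "(\<lambda>y. (spow \<alpha> (\<kappa> \<alpha> y) *v y) $ j) differentiable (at y)"
      unfolding spow_mult_vec by (intro differentiable_mult differentiable_power k_diff)
  qed
  have hs: "(\<lambda>y. h (spow \<alpha> (\<kappa> \<alpha> y) *v y)) differentiable (at y)"
    by (rule differentiable_compose[OF h sp])
  show ?thesis unfolding rescale_def[abs_def]
  proof (rule differentiable_vec_nthI)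
    fix j
    have "(\<lambda>t. t powr (- (k + real (\<alpha> j)))) differentiable (at (\<kappa> \<alpha> y))"
      using has_derivative_powr[OF has_derivative_ident has_derivative_const \<kappa>_pos[OF y], of UNIV]
        differentiableI by blast
    then have "(\<lambda>y. \<kappa> \<alpha> y powr (- (k + real (\<alpha> j)))) differentiable (at y)"
      by (rule differentiable_compose[OF _ k_diff])
    moreover have "(\<lambda>y. h (spow \<alpha> (\<kappa> \<alpha> y) *v y) $ j) differentiable (at y)"
      using hs bounded_linear.has_derivative[OF bounded_linear_vec_nth]
      unfolding differentiable_def by blast
    ultimately show "(\<lambda>y. (\<chi> i. \<kappa> \<alpha> y powr (- (k + real (\<alpha> i))) * h (spow \<alpha> (\<kappa> \<alpha> y) *v y) $ i) $ j)
        differentiable (at y)"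
      by (simp add: differentiable_mult)
  qed
qed

section \<open>Scaling relations for the leading part and its derivative\<close>

locale quasi_homogeneous_leading_part =
  fixes \<alpha> :: "'n::finite \<Rightarrow> nat" and k :: real and f F :: "real^'n \<Rightarrow> real^'n"
  assumes f_diff: "\<And>x. f differentiable (at x)"
    and F_C1: "C_k 1 F"
    and qh: "quasi_homogeneous \<alpha> k F"
begin

abbreviation "DF x \<equiv> frechet_derivative F (at x)"

lemma F_has_derivative: "(F has_derivative DF x) (at x)"
  using F_C1 by (simp add: frechet_derivative_works)

lemma isCont_DF: "isCont (\<lambda>x. DF x h) x"
  using F_C1 by (simp add: continuous_on_eq_continuous_at)

lemma F_spow:
  assumes "s > 0"
  shows "F (spow \<alpha> s *v x) = s powr k *\<^sub>R (spow \<alpha> s *v F x)"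
  using qh assms unfolding quasi_homogeneous_def
  by (simp add: Finite_Cartesian_Product.vec_eq_iff spow_mult_vec powr_add powr_realpow)

text \<open>Both sides of \<open>F_spow\<close> are differentiated in the space variable and
  compared by uniqueness of the derivative.\<close>

lemma DF_spow:
  assumes s: "s > 0"
  shows "DF (spow \<alpha> s *v x) (spow \<alpha> s *v h) = s powr k *\<^sub>R (spow \<alpha> s *v DF x h)"
proof -
  have lin: "(((*v) (spow \<alpha> s)) has_derivative ((*v) (spow \<alpha> s))) (at y)" for y
    by (rule bounded_linear_imp_has_derivative) (rule matrix_vector_mul_bounded_linear)
  have "((\<lambda>x. F (spow \<alpha> s *v x)) has_derivative (\<lambda>h. DF (spow \<alpha> s *v x) (spow \<alpha> s *v h))) (at x)"
    using has_derivative_compose[OF lin F_has_derivative] .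
  moreover have "((\<lambda>x. F (spow \<alpha> s *v x)) has_derivative (\<lambda>h. s powr k *\<^sub>R (spow \<alpha> s *v DF x h))) (at x)"
    unfolding F_spow[OF s]
    by (intro has_derivative_scaleR_right has_derivative_compose[OF F_has_derivative lin])
  ultimately show ?thesis using has_derivative_unique by metis
qed

text \<open>Euler's identity for a quasi-homogeneous field: \<open>F_spow\<close> differentiated in
  \<open>s\<close> at \<open>1\<close>.\<close>

lemma DF_Lam: "DF x (Lam \<alpha> *v x) = k *\<^sub>R F x + Lam \<alpha> *v F x"
proof -
  have "((\<lambda>s. F (spow \<alpha> s *v x)) has_derivative (\<lambda>h. DF x (h *\<^sub>R (Lam \<alpha> *v x)))) (at 1)"
    using has_derivative_compose[OF spow_has_derivative_at_1 F_has_derivative] by (simp add: spow_one)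
  moreover have "((\<lambda>s. F (spow \<alpha> s *v x)) has_derivative (\<lambda>h. h *\<^sub>R (k *\<^sub>R F x + Lam \<alpha> *v F x))) (at 1)"
  proof (rule has_derivative_transform_within_open)
    have "((\<lambda>s. s powr k) has_derivative (\<lambda>h. h * k)) (at 1)"
      using has_real_derivative_powr[of 1 k] unfolding has_field_derivative_def
      by (rule has_derivative_eq_rhs) auto
    from has_derivative_scaleR[OF this spow_has_derivative_at_1[of \<alpha> "F x"]]
    show "((\<lambda>s. s powr k *\<^sub>R (spow \<alpha> s *v F x)) has_derivative (\<lambda>h. h *\<^sub>R (k *\<^sub>R F x + Lam \<alpha> *v F x))) (at 1)"
      by (simp add: spow_one scaleR_add_right add.commute)
  qed (use F_spow in \<open>auto intro: open_greaterThan[of 0]\<close>)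
  ultimately have "(\<lambda>h. DF x (h *\<^sub>R (Lam \<alpha> *v x))) = (\<lambda>h. h *\<^sub>R (k *\<^sub>R F x + Lam \<alpha> *v F x))"
    by (rule has_derivative_unique)
  from fun_cong[OF this, of 1] show ?thesis by simp
qed

section \<open>The rescaled field as leading part plus residual\<close>

abbreviation "R \<equiv> ftilde_res \<alpha> k f F"

text \<open>Quasi-homogeneity cancels the powers of \<open>\<kappa>\<close> on the leading part,
  which survives the rescaling unchanged.\<close>

lemma ftilde_eq:
  assumes y: "y \<in> \<D> \<alpha>"
  shows "ftilde \<alpha> k f F y = F y + R y"
proof -
  have "\<kappa> \<alpha> y powr (- (k + real (\<alpha> i))) * F (spow \<alpha> (\<kappa> \<alpha> y) *v y) $ i = F y $ i" for i
  proof -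
    have "F (spow \<alpha> (\<kappa> \<alpha> y) *v y) $ i = \<kappa> \<alpha> y powr (k + real (\<alpha> i)) * F y $ i"
      using qh \<kappa>_pos[OF y] unfolding quasi_homogeneous_def by blast
    then show ?thesis using \<kappa>_pos[OF y] by (simp only: powr_minus) simp
  qed
  then show ?thesis using y
    by (simp add: ftilde_def ftilde_res_def rescale_def Finite_Cartesian_Product.vec_eq_iff
      right_diff_distrib)
qed

lemma R_has_derivative: "y \<in> \<D> \<alpha> \<Longrightarrow> (R has_derivative frechet_derivative R (at y)) (at y)"
  unfolding ftilde_res_def frechet_derivative_works[symmetric]
  using f_diff F_C1 by (intro rescale_differentiable differentiable_diff) simp_all

lemma ftilde_has_derivative:
  assumes "y \<in> \<D> \<alpha>"
  shows "(ftilde \<alpha> k f F has_derivative (\<lambda>h. DF y h + frechet_derivative R (at y) h)) (at y)"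
  by (rule has_derivative_transform_within_open[OF has_derivative_add[OF F_has_derivative R_has_derivative[OF assms]]
      open_\<D> assms]) (simp add: ftilde_eq)

section \<open>Limits at a fixed point of the horizon\<close>

context
  fixes x :: "real^'n"
  assumes x: "x \<in> horizon \<alpha>"
    and R_lim: "(R \<longlongrightarrow> 0) (at x within \<D> \<alpha>)"
    and DR_lim: "\<And>l. ((\<lambda>y. frechet_derivative R (at y) (axis l 1)) \<longlongrightarrow> 0) (at x within \<D> \<alpha>)"
begin

lemma ftilde_lim: "(ftilde \<alpha> k f F \<longlongrightarrow> F x) (at x within \<D> \<alpha>)"
proof (rule Lim_transform_eventually)
  have "isCont F x" by (rule has_derivative_continuous[OF F_has_derivative])
  then have "(F \<longlongrightarrow> F x) (at x within \<D> \<alpha>)"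
    using continuous_at_imp_continuous_at_within continuous_within by blast
  then show "((\<lambda>y. F y + R y) \<longlongrightarrow> F x) (at x within \<D> \<alpha>)"
    using tendsto_add[OF _ R_lim] by fastforce
qed (simp add: eventually_at_\<D> ftilde_eq)

lemma Dftilde_lim:
  "((\<lambda>y. DF y (axis l 1) + frechet_derivative R (at y) (axis l 1)) \<longlongrightarrow> DF x (axis l 1)) (at x within \<D> \<alpha>)"
proof -
  have "((\<lambda>y. DF y (axis l 1)) \<longlongrightarrow> DF x (axis l 1)) (at x within \<D> \<alpha>)"
    using continuous_at_imp_continuous_at_within[OF isCont_DF] continuous_within by blast
  from tendsto_add[OF this DR_lim] show ?thesis by simp
qed

text \<open>Inside the domain the derivative is that of \<open>F\<close>, which is continuous, plus
  that of the residual, which tends to zero.\<close>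

lemma horizon_jacobian_ftilde: "horizon_jacobian \<alpha> (ftilde \<alpha> k f F) x = jacobian F (at x)"
proof -
  have "((\<lambda>y. frechet_derivative (ftilde \<alpha> k f F) (at y) (axis l 1)) \<longlongrightarrow> DF x (axis l 1)) (at x within \<D> \<alpha>)" for l
    by (rule Lim_transform_eventually[OF Dftilde_lim], rule eventually_at_\<D>)
      (simp flip: frechet_derivative_at[OF ftilde_has_derivative])
  then show ?thesis
    by (simp add: Finite_Cartesian_Product.vec_eq_iff jacobian_nth horizon_jacobian_nth[OF x, where L = "DF x"])
qed

text \<open>Product rule inside the domain, then the limit of each factor. At the horizon
  \<open>1 - q\<close> vanishes, and the \<open>2 c\<close> from the derivative of \<open>q\<close>
  turns the prefactor \<open>(2 c - 1) / (2 c)\<close> into \<open>2 c - 1\<close>.\<close>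

lemma g_derivative_lim:
  "((\<lambda>y. frechet_derivative (g \<alpha> k f F) (at y) (axis l 1)) \<longlongrightarrow>
     (let h = axis l 1 in DF x h + ((2 * real (c \<alpha>) - 1) * (grad_q \<alpha> x \<bullet> h)) *\<^sub>R F x
       - ((grad_q \<alpha> x \<bullet> F x) *\<^sub>R (Lam \<alpha> *v h)
          + (grad_q \<alpha> x \<bullet> DF x h + Dgrad_q \<alpha> x h \<bullet> F x) *\<^sub>R (Lam \<alpha> *v x))))
   (at x within \<D> \<alpha>)"
proof -
  let ?a = "(2 * real (c \<alpha>) - 1) / (2 * real (c \<alpha>))"
  let ?\<Phi> = "\<lambda>y h. DF y h + frechet_derivative R (at y) h"
  let ?ft = "ftilde \<alpha> k f F"
  define D where "D y h =
      ((1 - ?a * (1 - q \<alpha> y)) *\<^sub>R ?\<Phi> y h + (?a * (2 * real (c \<alpha>) * (grad_q \<alpha> y \<bullet> h))) *\<^sub>R ?ft y)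
      - ((grad_q \<alpha> y \<bullet> ?ft y) *\<^sub>R (Lam \<alpha> *v h)
         + (grad_q \<alpha> y \<bullet> ?\<Phi> y h + Dgrad_q \<alpha> y h \<bullet> ?ft y) *\<^sub>R (Lam \<alpha> *v y))" for y h
  have g_eq: "g \<alpha> k f F = (\<lambda>y. (1 - ?a * (1 - q \<alpha> y)) *\<^sub>R ?ft y - (grad_q \<alpha> y \<bullet> ?ft y) *\<^sub>R (Lam \<alpha> *v y))"
    by (rule ext) (simp add: g_def G_eq p_power)
  have "(g \<alpha> k f F has_derivative D y) (at y)" if y: "y \<in> \<D> \<alpha>" for y
  proof -
    have "((\<lambda>y. 1 - ?a * (1 - q \<alpha> y)) has_derivative
        (\<lambda>h. ?a * (2 * real (c \<alpha>) * (grad_q \<alpha> y \<bullet> h)))) (at y)"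
      by (rule has_derivative_eq_rhs, (rule derivative_intros q_has_derivative)+) auto
    moreover have "((\<lambda>y. Lam \<alpha> *v y) has_derivative (\<lambda>h. Lam \<alpha> *v h)) (at y)"
      by (rule bounded_linear_imp_has_derivative) (rule matrix_vector_mul_bounded_linear)
    ultimately show ?thesis unfolding g_eq D_def
      by (intro has_derivative_diff has_derivative_scaleR has_derivative_inner
          grad_q_has_derivative ftilde_has_derivative[OF y])
  qed
  then have Dg: "frechet_derivative (g \<alpha> k f F) (at y) = D y" if "y \<in> \<D> \<alpha>" for y
    using that frechet_derivative_at by metis
  let ?A = "at x within \<D> \<alpha>"
  have grad: "(grad_q \<alpha> \<longlongrightarrow> grad_q \<alpha> x) ?A"
    using has_derivative_continuous[OF grad_q_has_derivative[of \<alpha> x]]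
      continuous_at_imp_continuous_at_within continuous_within by blast
  have Dgrad: "((\<lambda>y. Dgrad_q \<alpha> y h) \<longlongrightarrow> Dgrad_q \<alpha> x h) ?A" for h
    unfolding Dgrad_q_def
    by (intro vec_tendstoI) (auto intro!: tendsto_intros simp: J_def)
  have Lam: "((\<lambda>y. Lam \<alpha> *v y) \<longlongrightarrow> Lam \<alpha> *v x) ?A"
    by (intro bounded_linear.tendsto[OF matrix_vector_mul_bounded_linear] tendsto_ident_at)
  have "((\<lambda>y. D y (axis l 1)) \<longlongrightarrow>
      ((1 - ?a * (1 - 1)) *\<^sub>R DF x (axis l 1) + (?a * (2 * real (c \<alpha>) * (grad_q \<alpha> x \<bullet> axis l 1))) *\<^sub>R F x)
      - ((grad_q \<alpha> x \<bullet> F x) *\<^sub>R (Lam \<alpha> *v axis l 1)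
         + (grad_q \<alpha> x \<bullet> DF x (axis l 1) + Dgrad_q \<alpha> x (axis l 1) \<bullet> F x) *\<^sub>R (Lam \<alpha> *v x))) ?A"
    unfolding D_def
    by (intro tendsto_diff tendsto_add tendsto_scaleR tendsto_inner tendsto_mult tendsto_const
        q_tendsto_horizon[OF x] Dftilde_lim ftilde_lim grad Dgrad Lam)
  then have "((\<lambda>y. frechet_derivative (g \<alpha> k f F) (at y) (axis l 1)) \<longlongrightarrow>
      ((1 - ?a * (1 - 1)) *\<^sub>R DF x (axis l 1) + (?a * (2 * real (c \<alpha>) * (grad_q \<alpha> x \<bullet> axis l 1))) *\<^sub>R F x)
      - ((grad_q \<alpha> x \<bullet> F x) *\<^sub>R (Lam \<alpha> *v axis l 1)
         + (grad_q \<alpha> x \<bullet> DF x (axis l 1) + Dgrad_q \<alpha> x (axis l 1) \<bullet> F x) *\<^sub>R (Lam \<alpha> *v x))) ?A"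
    by (rule Lim_transform_eventually) (simp add: eventually_at_\<D> Dg)
  moreover have "?a * (2 * real (c \<alpha>) * t) = (2 * real (c \<alpha>) - 1) * t" for t
    using c_pos[of \<alpha>] by simp
  ultimately show ?thesis by (simp add: Let_def)
qed

text \<open>The entries of \<open>(I - P) Ag - C P\<close>. Once \<open>F x\<close> is
  \<open>C\<close> times \<open>Lam \<alpha> *v x\<close>, the coefficient
  \<open>(2 c - 1) C\<close> and the \<open>2 c C\<close> from \<open>Dgrad_q_Lam\<close> combine to
  \<open>- C\<close>; the other term of \<open>Dgrad_q_Lam\<close> completes the pairing with the
  derivative of \<open>F\<close> to one with \<open>Ag\<close>.\<close>

lemma horizon_jacobian_g:
  assumes F: "F x = C *\<^sub>R (Lam \<alpha> *v x)"
  defines "Ag \<equiv> - C *\<^sub>R Lam \<alpha> + horizon_jacobian \<alpha> (ftilde \<alpha> k f F) x"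
  shows "horizon_jacobian \<alpha> (g \<alpha> k f F) x $ i $ l =
    Ag $ i $ l - (Lam \<alpha> *v x) $ i * ((\<Sum>j\<in>UNIV. grad_q \<alpha> x $ j * Ag $ j $ l) + C * grad_q \<alpha> x $ l)"
proof -
  let ?v = "Lam \<alpha> *v x" and ?w = "grad_q \<alpha> x" and ?e = "axis l 1 :: real^'n"
  have Ag_axis: "Ag *v h = DF x h - C *\<^sub>R (Lam \<alpha> *v h)" for h
    using jacobian_mult_vec[OF differentiableI[OF F_has_derivative]]
    by (simp add: Ag_def horizon_jacobian_ftilde matrix_vector_mult_diff_rdistrib
        flip: scaleR_matrix_vector_assoc)
  have Ag_nth: "Ag $ j $ l = (Ag *v ?e) $ j" for j
    by (simp add: matrix_vector_mult_axis column_def)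
  have "horizon_jacobian \<alpha> (g \<alpha> k f F) x $ i $ l =
     (let h = axis l 1 in DF x h + ((2 * real (c \<alpha>) - 1) * (?w \<bullet> h)) *\<^sub>R F x
       - ((?w \<bullet> F x) *\<^sub>R (Lam \<alpha> *v h) + (?w \<bullet> DF x h + Dgrad_q \<alpha> x h \<bullet> F x) *\<^sub>R ?v)) $ i"
    by (rule horizon_jacobian_nth[OF x, OF g_derivative_lim])
  also have "\<dots> = (Ag *v ?e - ((?w \<bullet> (Ag *v ?e)) + C * (?w \<bullet> ?e)) *\<^sub>R ?v) $ i"
    unfolding Let_def F Ag_axis inner_scaleR_right Dgrad_q_Lam
    by (simp add: grad_q_Lam[OF x] inner_diff_right algebra_simps)
  also have "\<dots> = Ag $ i $ l - ?v $ i * ((\<Sum>j\<in>UNIV. ?w $ j * Ag $ j $ l) + C * ?w $ l)"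
    unfolding Ag_nth by (simp add: inner_vec_def[of ?w "Ag *v ?e"] inner_axis)
  finally show ?thesis .
qed

end

end

section \<open>Correspondence of eigenpairs\<close>

lemma cmat_mult_cvec: "cmat M *v cvec x = cvec (M *v x)"
  by (simp add: Finite_Cartesian_Product.vec_eq_iff cvec_def matrix_vector_mult_def)

lemma cmat_matrix_mult: "cmat (M ** N) = cmat M ** cmat N"
  by (simp add: Finite_Cartesian_Product.vec_eq_iff matrix_matrix_mult_def)

lemma cmat_scaleR_mult_vec: "cmat (a *\<^sub>R M) *v x = of_real a *s (cmat M *v x)"
  by (simp add: Finite_Cartesian_Product.vec_eq_iff matrix_vector_mult_def sum_distrib_left mult.assoc)

lemma cvec_scaleR: "cvec (a *\<^sub>R x) = of_real a *s cvec x"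
  by (simp add: Finite_Cartesian_Product.vec_eq_iff cvec_def)

lemma spow_mult_spow_inverse: "s \<noteq> 0 \<Longrightarrow> spow \<alpha> s ** spow \<alpha> (1 / s) = scalar_mat 1"
  unfolding matrix_eq by (simp flip: matrix_vector_mul_assoc add: spow_spow spow_one)

lemma Lam_spow_commute: "Lam \<alpha> *v (spow \<alpha> s *v x) = spow \<alpha> s *v (Lam \<alpha> *v x)"
  by (simp add: Finite_Cartesian_Product.vec_eq_iff Lam_mult_vec spow_mult_vec)

context quasi_homogeneous_leading_part
begin

text \<open>\<open>\<kappa>\<close> blows up at the horizon, so bounds by \<open>\<kappa>\<close> to
  the power \<open>- (1 + \<epsilon>)\<close> force the residual and its derivative to zero.\<close>

lemma residual_limits:
  assumes x: "x \<in> horizon \<alpha>" and eps: "\<epsilon> > 0"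
    and res_O: "\<And>i. (\<lambda>x. R x $ i) \<in> O[at x within \<D> \<alpha>](\<lambda>x. \<kappa> \<alpha> x powr (- (1 + \<epsilon>)))"
    and dres_o: "\<And>i l. (\<lambda>x. jacobian R (at x) $ i $ l)
          \<in> o[at x within \<D> \<alpha>](\<lambda>x. \<kappa> \<alpha> x powr (- (1 + \<epsilon>)))"
  shows "(R \<longlongrightarrow> 0) (at x within \<D> \<alpha>)"
    and "((\<lambda>y. frechet_derivative R (at y) (axis l 1)) \<longlongrightarrow> 0) (at x within \<D> \<alpha>)"
proof -
  have small: "(\<lambda>y. \<kappa> \<alpha> y powr (- (1 + \<epsilon>))) \<in> o[at x within \<D> \<alpha>](\<lambda>_. 1)"
    using \<kappa>_powr_smallo[OF x, of "1 + \<epsilon>"] eps by simp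
  have "((\<lambda>y. R y $ i) \<longlongrightarrow> 0) (at x within \<D> \<alpha>)" for i
    using smalloD_tendsto[OF landau_o.big_small_trans[OF res_O small]] by simp
  then show "(R \<longlongrightarrow> 0) (at x within \<D> \<alpha>)"
    by (intro vec_tendstoI) simp
  have "((\<lambda>y. jacobian R (at y) $ i $ l) \<longlongrightarrow> 0) (at x within \<D> \<alpha>)" for i
    using smalloD_tendsto[OF landau_o.small_trans[OF dres_o small]] by simp
  then show "((\<lambda>y. frechet_derivative R (at y) (axis l 1)) \<longlongrightarrow> 0) (at x within \<D> \<alpha>)"
    by (intro vec_tendstoI) (simp add: jacobian_nth)
qed

text \<open>On the horizon the scalar prefactor in \<open>g\<close> is \<open>1\<close> and
  \<open>ftilde\<close> is \<open>F\<close>.\<close>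

lemma equilibrium_leading_part:
  assumes x: "x \<in> horizon \<alpha>" and "g \<alpha> k f F x = 0"
  shows "F x = G \<alpha> k f F x *\<^sub>R (Lam \<alpha> *v x)"
proof -
  have "ftilde \<alpha> k f F x = F x" using x by (simp add: ftilde_def \<D>_def horizon_def)
  then show ?thesis using assms by (simp add: g_def p_power mem_horizon_iff)
qed

lemma leading_jacobian_mult_vec: "jacobian F (at x) *v h = DF x h"
  by (rule jacobian_mult_vec[OF differentiableI[OF F_has_derivative]])

text \<open>By Euler's identity \<open>DF\<close> maps \<open>\<Lambda> x\<close> to
  \<open>k F + \<Lambda> F\<close>; with \<open>F = C \<Lambda> x\<close> the second term cancels
  against \<open>- C \<Lambda>\<close>.\<close>

lemma equilibrium_eigenvector:
  assumes F: "F x = C *\<^sub>R (Lam \<alpha> *v x)"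
  shows "(- C *\<^sub>R Lam \<alpha> + jacobian F (at x)) *v (Lam \<alpha> *v x) = (k * C) *\<^sub>R (Lam \<alpha> *v x)"
  by (simp add: matrix_vector_mult_diff_rdistrib leading_jacobian_mult_vec DF_Lam F
      matrix_vector_mult_scaleR flip: scaleR_matrix_vector_assoc)

text \<open>\<open>\<Lambda>\<close> commutes with the scaling, \<open>DF_spow\<close> contributes
  the factor \<open>s powr k = 1 / (k C)\<close>, and the same factor comes out of
  \<open>1 / k = C / (k C)\<close>.\<close>

lemma power_matrix_conjugate:
  assumes s: "s > 0" and sk: "s powr k = 1 / (k * C)" and C: "C \<noteq> 0"
  shows "(- (1 / k) *\<^sub>R Lam \<alpha> + jacobian F (at (spow \<alpha> s *v x))) ** spow \<alpha> s =
    (1 / (k * C)) *\<^sub>R (spow \<alpha> s ** (- C *\<^sub>R Lam \<alpha> + jacobian F (at x)))"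
  unfolding matrix_eq
proof
  fix h
  have "((- (1 / k) *\<^sub>R Lam \<alpha> + jacobian F (at (spow \<alpha> s *v x))) ** spow \<alpha> s) *v h =
      (1 / (k * C)) *\<^sub>R (spow \<alpha> s *v DF x h) - (1 / k) *\<^sub>R (spow \<alpha> s *v (Lam \<alpha> *v h))"
    by (simp add: matrix_vector_mult_diff_rdistrib leading_jacobian_mult_vec DF_spow[OF s] sk
        Lam_spow_commute flip: matrix_vector_mul_assoc scaleR_matrix_vector_assoc)
  also have "\<dots> = (1 / (k * C)) *\<^sub>R (spow \<alpha> s *v (DF x h - C *\<^sub>R (Lam \<alpha> *v h)))"
    using C by (simp add: matrix_vector_mult_diff_distrib matrix_vector_mult_scaleR scaleR_diff_right)
  also have "\<dots> = ((1 / (k * C)) *\<^sub>R (spow \<alpha> s ** (- C *\<^sub>R Lam \<alpha> + jacobian F (at x)))) *v h"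
    by (simp add: matrix_vector_mult_diff_rdistrib leading_jacobian_mult_vec
        flip: matrix_vector_mul_assoc scaleR_matrix_vector_assoc)
  finally show "((- (1 / k) *\<^sub>R Lam \<alpha> + jacobian F (at (spow \<alpha> s *v x))) ** spow \<alpha> s) *v h =
    ((1 / (k * C)) *\<^sub>R (spow \<alpha> s ** (- C *\<^sub>R Lam \<alpha> + jacobian F (at x)))) *v h" .
qed

end

text \<open>Matrices are complex so that real Jacobians have all their eigenvalues. That all
  eigenpairs are reached is expressed by converses: every generalized eigenvector of
  \<open>Dg\<close> splits into a multiple of \<open>Lx\<close> and a projected vector. The order
  \<open>m'\<close> is left free only at \<open>k C\<close>, where a chain of \<open>A\<close> may
  end in \<open>LY\<close> and the projection shortens it.\<close>

theorem theorem3p20: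
  fixes \<alpha> :: "'n::finite \<Rightarrow> nat" and k \<epsilon> C rx rY :: real and r :: nat
    and f F :: "real^'n \<Rightarrow> real^'n" and xs Y0 :: "real^'n"
    and A Ag Dg P :: "complex^'n^'n" and Lx LY :: "complex^'n"
  assumes alpha: "\<exists>i. \<alpha> i \<noteq> 0" and k: "k > 0"
    and f_smooth: "r \<ge> 2" "C_k r f"
    and F_C1: "C_k 1 F"
    and f_asymp: "asymp_quasi_homogeneous \<alpha> k f F"
    and eps: "\<epsilon> > 0"
    and res_O: "\<And>x0 i. x0 \<in> horizon \<alpha> \<Longrightarrow>
        (\<lambda>x. ftilde_res \<alpha> k f F x $ i)
          \<in> O[at x0 within \<D> \<alpha>](\<lambda>x. \<kappa> \<alpha> x powr (- (1 + \<epsilon>)))"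
    and dres_o: "\<And>x0 i l. x0 \<in> horizon \<alpha> \<Longrightarrow>
        (\<lambda>x. jacobian (ftilde_res \<alpha> k f F) (at x) $ i $ l)
          \<in> o[at x0 within \<D> \<alpha>](\<lambda>x. \<kappa> \<alpha> x powr (- (1 + \<epsilon>)))"
    and equilibrium: "xs \<in> horizon \<alpha>" "g \<alpha> k f F xs = 0"
    and C: "C = G \<alpha> k f F xs" "C > 0"
    and rx: "rx = (k * C) powr (- 1 / k)"
    and rY: "rY = p \<alpha> Y0"
    and balance: "Y0 \<noteq> 0" "- (1 / k) *\<^sub>R (Lam \<alpha> *v Y0) + F Y0 = 0"
    and Y0_xs: "Y0 = spow \<alpha> rx *v xs" and xs_Y0: "xs = spow \<alpha> (1 / rY) *v Y0"
    and A: "A = cmat (- (1 / k) *\<^sub>R Lam \<alpha> + jacobian F (at Y0))"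
    and Ag: "Ag = cmat (- C *\<^sub>R Lam \<alpha> + horizon_jacobian \<alpha> (ftilde \<alpha> k f F) xs)"
    and Dg: "Dg = cmat (horizon_jacobian \<alpha> (g \<alpha> k f F) xs)"
    and P: "P = cmat (\<chi> i j. (Lam \<alpha> *v xs) $ i * grad_p \<alpha> xs $ j)"
    and LY: "LY = cvec (Lam \<alpha> *v Y0)"
    and Lx: "Lx = cvec (Lam \<alpha> *v xs)"
  shows "
    \<comment> \<open>(1): common eigenpair, remaining eigenvalues, remaining (generalized) eigenvectors\<close>
    (gen_eigenvector A 1 1 LY \<and>
     gen_eigenvector Dg (- of_real C) 1 (cvec (Lam \<alpha> *v (spow \<alpha> (1 / rY) *v Y0)))) \<and>
    (eigenvalues_mset Dg =
       {# - of_real C #} + {# of_real (rY powr (- k)) * \<mu>. \<mu> \<in># eigenvalues_mset A - {#1#} #}) \<and>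
    (\<forall>\<mu> m U. gen_eigenvector A \<mu> m U \<and> (\<nexists>a. U = a *s LY) \<longrightarrow>
       gen_eigenvector Dg (of_real (rY powr (- k)) * \<mu>) m
         ((scalar_mat 1 - P) *v (cmat (spow \<alpha> (1 / rY)) *v U))) \<and>
    (\<forall>\<nu> m V. gen_eigenvector Dg \<nu> m V \<longrightarrow>
       (\<exists>a U. V = a *s Lx + (scalar_mat 1 - P) *v (cmat (spow \<alpha> (1 / rY)) *v U) \<and>
          (a \<noteq> 0 \<longrightarrow> \<nu> = - of_real C) \<and>
          (U \<noteq> 0 \<longrightarrow> (\<nexists>b. U = b *s LY) \<and>
             (\<exists>m'. (\<nu> \<noteq> of_real (k * C) \<longrightarrow> m' = m) \<and>
                gen_eigenvector A (of_real (rY powr k) * \<nu>) m' U)))) \<and>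
    \<comment> \<open>(2): the same in the opposite direction\<close>
    (gen_eigenvector Dg (- of_real C) 1 Lx \<and>
     gen_eigenvector A 1 1 (cvec (Lam \<alpha> *v (spow \<alpha> rx *v xs)))) \<and>
    (eigenvalues_mset A =
       {#1#} + {# of_real (rx powr k) * \<nu>. \<nu> \<in># eigenvalues_mset Dg - {# - of_real C #} #}) \<and>
    (\<forall>\<nu> m u. gen_eigenvector Dg \<nu> m ((scalar_mat 1 - P) *v u) \<longrightarrow>
       (let U = cmat (spow \<alpha> rx) *v ((Ag - scalar_mat (of_real (k * C))) *v u)
        in gen_eigenvector A (of_real (rx powr k) * \<nu>) m U \<or>
           \<nu> = of_real (k * C) \<and> U = 0 \<and> gen_eigenvector A 1 1 (cmat (spow \<alpha> rx) *v u))) \<and>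
    (\<forall>\<mu> m U. \<mu> \<noteq> 1 \<and> gen_eigenvector A \<mu> m U \<longrightarrow>
       (\<exists>u. gen_eigenvector Dg (of_real (rx powr (- k)) * \<mu>) m ((scalar_mat 1 - P) *v u) \<and>
            U = cmat (spow \<alpha> rx) *v ((Ag - scalar_mat (of_real (k * C))) *v u))) \<and>
    (\<forall>m U. gen_eigenvector A 1 m U \<and> (\<nexists>a. U = a *s LY) \<longrightarrow>
       (\<exists>u. gen_eigenvector Dg (of_real (k * C)) m ((scalar_mat 1 - P) *v u) \<and>
            U = cmat (spow \<alpha> rx) *v u)) \<and>
    \<comment> \<open>(3): Jordan blocks as pairs (size, eigenvalue); the block of the common
      eigenpair of \<open>Dg\<close> is \<open>(1, - C)\<close>\<close>
    (\<forall>bA bD. jordan_nf (jnf_mat A) bA \<and> jordan_nf (jnf_mat Dg) bD \<longrightarrow>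
       (1, - of_real C) \<in># mset bD \<and>
       (\<forall>\<mu>. \<mu> \<noteq> 1 \<longrightarrow> (\<forall>m.
          count (mset bA) (m, \<mu>) =
          count (mset bD - {# (1, - of_real C) #}) (m, of_real (rY powr (- k)) * \<mu>))))"
proof -

  \<comment> \<open>Constants relating the equilibrium to the root of the balance law\<close>
  obtain r' where r': "r = Suc r'" using f_smooth(1) by (cases r) auto
  interpret L: quasi_homogeneous_leading_part \<alpha> k f F
    using f_smooth(2) F_C1 f_asymp
    by unfold_locales (auto simp: r' asymp_quasi_homogeneous_def)
  have kC: "k * C > 0" using k C(2) by simp
  have rx_pos: "rx > 0" using k C(2) by (simp add: rx)
  have rxk: "rx powr k = 1 / (k * C)"
    unfolding rx powr_powr using k powr_neg_one[OF kC] by simp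
  have rxmk: "rx powr (- k) = k * C" using rxk by (simp add: powr_minus)
  have rY_rx: "rY = rx"
    unfolding rY Y0_xs by (rule p_spow_horizon[OF equilibrium(1) rx_pos])

  \<comment> \<open>Deflation structure of \<open>Dg\<close>\<close>
  let ?v = "Lam \<alpha> *v xs" and ?w = "grad_p \<alpha> xs"
  let ?Ag = "- C *\<^sub>R Lam \<alpha> + horizon_jacobian \<alpha> (ftilde \<alpha> k f F) xs"
  note lims = L.residual_limits[OF equilibrium(1) eps res_O[OF equilibrium(1)] dres_o[OF equilibrium(1)]]
  have Fxs: "F xs = C *\<^sub>R ?v"
    unfolding C(1) by (rule L.equilibrium_leading_part[OF equilibrium])
  note hj = L.horizon_jacobian_ftilde[OF equilibrium(1) lims]
  note w_eq = grad_p_eq[OF equilibrium(1)]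
  define wc where "wc = cvec ?w"
  have Ag_nth: "Ag $ i $ l = of_real (?Ag $ i $ l)" for i l
    unfolding Ag by simp
  have Dg_nth: "Dg $ i $ l = Ag $ i $ l - Lx $ i * ((\<Sum>j\<in>UNIV. wc $ j * Ag $ j $ l) + of_real C * wc $ l)" for i l
    unfolding Ag_nth Dg nth_map_matrix L.horizon_jacobian_g[OF equilibrium(1) lims Fxs]
    by (simp add: wc_def Lx cvec_def w_eq)
  have Ag_Lx: "Ag *v Lx = of_real (k * C) *s Lx"
    unfolding Ag Lx cmat_mult_cvec hj L.equilibrium_eigenvector[OF Fxs] cvec_scaleR ..
  have wv: "(\<Sum>i\<in>UNIV. wc $ i * Lx $ i) = 1"
  proof -
    have "(\<Sum>i\<in>UNIV. wc $ i * Lx $ i) = of_real (?w \<bullet> ?v)"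
      by (simp add: wc_def Lx cvec_def inner_vec_def)
    then show ?thesis using grad_q_Lam[OF equilibrium(1)] w_eq by simp
  qed
  have Dg_mult: "Dg *v x = Ag *v x - ((\<Sum>i\<in>UNIV. wc $ i * (Ag *v x) $ i)
      - (- of_real C) * (\<Sum>i\<in>UNIV. wc $ i * x $ i)) *s Lx" for x
  proof -
    define z where "z l = (\<Sum>j\<in>UNIV. wc $ j * Ag $ j $ l)" for l
    have z: "(\<Sum>l\<in>UNIV. z l * x $ l) = (\<Sum>j\<in>UNIV. wc $ j * (Ag *v x) $ j)"
      unfolding z_def matrix_vector_mult_def vec_lambda_beta sum_distrib_left sum_distrib_right
      by (subst sum.swap) (simp add: mult.assoc)
    have "(Dg *v x) $ i = (Ag *v x) $ i - Lx $ i * ((\<Sum>l\<in>UNIV. z l * x $ l)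
        + of_real C * (\<Sum>l\<in>UNIV. wc $ l * x $ l))" for i
      unfolding matrix_vector_mult_def[of Dg] Dg_nth vec_lambda_beta z_def[symmetric]
      by (simp add: matrix_vector_mult_def[of Ag] left_diff_distrib distrib_right distrib_left
          sum_subtractf sum.distrib sum_distrib_left mult.assoc)
    note this[unfolded z]
    then show ?thesis by (simp add: Finite_Cartesian_Product.vec_eq_iff mult.commute distrib_left)
  qed
  \<comment> \<open>\<open>Ag\<close> has the eigenvalue \<open>k C\<close> at \<open>Lx\<close>,
    and \<open>Dg\<close> replaces it by \<open>- C\<close>.\<close>
  interpret E: deflation Ag Dg Lx wc "of_real (k * C)" "- of_real C"
    using wv Ag_Lx Dg_mult by unfold_locales
  have proj: "(scalar_mat 1 - P) *v x = E.proj x" for x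
  proof -
    have "P $ i $ j = Lx $ i * wc $ j" for i j
      by (simp add: P Lx wc_def cvec_def)
    then have "P *v x = E.coeff x *s Lx"
      by (simp add: Finite_Cartesian_Product.vec_eq_iff matrix_vector_mult_def E.coeff_def
          sum_distrib_left mult_ac)
    then show ?thesis by (simp add: E.proj_def matrix_vector_mult_diff_rdistrib)
  qed

  \<comment> \<open>Conjugation between \<open>A\<close> and \<open>Ag\<close>\<close>
  let ?S = "cmat (spow \<alpha> rx)" and ?T = "cmat (spow \<alpha> (1 / rY))"
  have cmat_one: "cmat (scalar_mat 1 :: real^'n^'n) = scalar_mat 1"
    by (simp add: Finite_Cartesian_Product.vec_eq_iff Finite_Cartesian_Product.mat_def)
  have ST: "?S ** ?T = scalar_mat 1"
    using spow_mult_spow_inverse[of rx \<alpha>] rx_pos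
    by (simp add: rY_rx cmat_one flip: cmat_matrix_mult)
  have TS: "?T ** ?S = scalar_mat 1"
    using ST matrix_left_right_inverse by blast
  have STx: "?S *v (?T *v x) = x" and TSx: "?T *v (?S *v x) = x" for x
    by (simp_all add: matrix_vector_mul_assoc ST TS)
  have AS: "A ** ?S = cmat ((1 / (k * C)) *\<^sub>R (spow \<alpha> rx ** ?Ag))"
    unfolding A cmat_matrix_mult[symmetric] Y0_xs hj
    by (subst L.power_matrix_conjugate[OF rx_pos rxk]) (use C(2) in simp_all)
  have A_S: "A *v (?S *v x) = inverse (of_real (k * C)) *s (?S *v (Ag *v x))" for x
    unfolding matrix_vector_mul_assoc AS cmat_scaleR_mult_vec Ag cmat_matrix_mult
    by (simp add: field_class.field_divide_inverse)
  have kC0: "complex_of_real (k * C) \<noteq> 0" using k C(2) by simp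
  \<comment> \<open>This says that \<open>?S *v x\<close> is a generalized eigenvector of
    \<open>A\<close> for \<open>\<mu>\<close> exactly when \<open>x\<close> is one of
    \<open>Ag\<close> for \<open>k C \<mu>\<close>.\<close>
  note conj = gen_eigenvector_conjugate[OF ST TS kC0 A_S]
  have LY_S: "LY = ?S *v Lx"
    unfolding LY Lx Y0_xs Lam_spow_commute cmat_mult_cvec ..
  have S_span: "(\<exists>b. ?S *v x = b *s LY) \<longleftrightarrow> (\<exists>b. x = b *s Lx)" for x
    unfolding LY_S vector_scalar_commute[symmetric] by (metis TSx)
  have eigA: "gen_eigenvector A 1 1 LY"
    unfolding LY_S conj using Ag_Lx E.v_nonzero by (simp add: gen_eigenvector_def shift_apply)
  have eigD: "gen_eigenvector Dg (- of_real C) 1 Lx"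
    using E.D_v E.v_nonzero by (simp add: gen_eigenvector_def shift_apply)

  \<comment> \<open>Common block form and eigenvalue multisets\<close>
  have wD: "wc v* Dg = (- of_real C) *s wc"
  proof -
    have "E.coeff (axis l 1) = wc $ l" for l
      by (simp add: E.coeff_def axis_def if_distrib[of "(*) (wc $ i)" for i] cong: if_cong)
    moreover have "E.coeff (Dg *v axis l 1) = (wc v* Dg) $ l" for l
      by (simp add: E.coeff_def matrix_vector_mult_axis column_def vector_matrix_mult_def)
    ultimately show ?thesis
      using E.coeff_D by (simp add: Finite_Cartesian_Product.vec_eq_iff)
  qed
  have TAS: "?T ** A ** ?S *v x = inverse (of_real (k * C)) *s (Ag *v x)" for x
    by (simp add: A_S vector_scalar_commute TSx flip: matrix_vector_mul_assoc)
  have TAS_nth: "of_real (k * C) * (?T ** A ** ?S) $ i $ l = Ag $ i $ l" for i l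
  proof -
    have "(?T ** A ** ?S) $ i $ l = inverse (of_real (k * C)) * Ag $ i $ l"
      using arg_cong[OF TAS[of "axis l 1"], of "\<lambda>y. y $ i"]
      by (simp add: matrix_vector_mult_axis column_def del: of_real_mult)
    then show ?thesis using kC0 by (simp add: mult.assoc[symmetric] del: of_real_mult)
  qed
  obtain Z N m where Z: "Z \<in> carrier_mat 1 m" and N: "N \<in> carrier_mat m m"
    and simA: "similar_mat (jnf_mat (?T ** A ** ?S)) (four_block_mat (1 \<cdot>\<^sub>m 1\<^sub>m 1) Z (0\<^sub>m m 1) N)"
    and simD: "similar_mat (jnf_mat Dg)
      (four_block_mat (- of_real C \<cdot>\<^sub>m 1\<^sub>m 1) (0\<^sub>m 1 m) (0\<^sub>m m 1) (of_real (k * C) \<cdot>\<^sub>m N))"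
  \<comment> \<open>The conjugate of \<open>A\<close> replaces \<open>Ag\<close> here: its
    eigenvalue at \<open>Lx\<close> is \<open>1\<close>, and \<open>k C\<close> becomes the ratio of
    the lower blocks.\<close>
  proof (rule similar_common_four_block[OF wv _ E.D_v wD])
    show "?T ** A ** ?S *v Lx = 1 *s Lx"
      unfolding TAS Ag_Lx using kC0 by (simp add: vector_smult_assoc del: of_real_mult)
    show "Dg $ i $ l = of_real (k * C) * (?T ** A ** ?S) $ i $ l
        - Lx $ i * (\<chi> l. (\<Sum>j\<in>UNIV. wc $ j * Ag $ j $ l) + of_real C * wc $ l) $ l" for i l
      unfolding TAS_nth Dg_nth by simp
  qed
  have simA': "similar_mat (jnf_mat A) (four_block_mat (1 \<cdot>\<^sub>m 1\<^sub>m 1) Z (0\<^sub>m m 1) N)"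
    by (rule similar_mat_trans[OF jnf_mat_similar[OF ST TS] simA])
  note blocks = jordan_structure_blocks[OF simA' simD Z N kC0]
  obtain X where XA: "eigenvalues_mset A = add_mset 1 X"
    and XD: "eigenvalues_mset Dg = add_mset (- of_real C) (image_mset ((*) (of_real (k * C))) X)"
    using blocks(1) unfolding eigenvalues_mset_def by blast

  \<comment> \<open>Transfer to the stated correspondences\<close>
  have "gen_eigenvector Dg (- of_real C) 1 (cvec (Lam \<alpha> *v (spow \<alpha> (1 / rY) *v Y0)))"
    using eigD unfolding xs_Y0[symmetric] Lx .
  moreover have "eigenvalues_mset Dg = {# - of_real C #} +
      {# of_real (rY powr (- k)) * \<mu>. \<mu> \<in># eigenvalues_mset A - {#1#} #}"
    unfolding XA XD rY_rx rxmk by simp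
  moreover have "gen_eigenvector Dg (of_real (rY powr (- k)) * \<mu>) m
      ((scalar_mat 1 - P) *v (?T *v U))"
    if "gen_eigenvector A \<mu> m U" "\<nexists>a. U = a *s LY" for \<mu> m U
    unfolding proj
  proof -
    have "gen_eigenvector A \<mu> m (?S *v (?T *v U))" using that(1) by (simp add: STx)
    then have "gen_eigenvector Ag (of_real (k * C) * \<mu>) m (?T *v U)" by (simp only: conj)
    moreover have "\<nexists>b. ?T *v U = b *s Lx" using that(2) S_span[of "?T *v U"] by (simp add: STx)
    ultimately show "gen_eigenvector Dg (of_real (rY powr (- k)) * \<mu>) m (E.proj (?T *v U))"
      unfolding rY_rx rxmk by (rule E.gen_eigenvector_proj)
  qed
  moreover have "\<exists>a U. V = a *s Lx + (scalar_mat 1 - P) *v (?T *v U) \<and>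
      (a \<noteq> 0 \<longrightarrow> \<nu> = - of_real C) \<and>
      (U \<noteq> 0 \<longrightarrow> (\<nexists>b. U = b *s LY) \<and>
        (\<exists>m'. (\<nu> \<noteq> of_real (k * C) \<longrightarrow> m' = m) \<and>
          gen_eigenvector A (of_real (rY powr k) * \<nu>) m' U))"
    if V: "gen_eigenvector Dg \<nu> m V" for \<nu> m V
  proof -
    obtain b u where V_eq: "V = b *s Lx + E.proj u" and b: "b \<noteq> 0 \<longrightarrow> \<nu> = - of_real C" and
      u: "u \<noteq> 0 \<longrightarrow> (\<nexists>b. u = b *s Lx) \<and>
        (\<exists>m'. (\<nu> \<noteq> of_real (k * C) \<longrightarrow> m' = m) \<and> gen_eigenvector Ag \<nu> m' u)"
      using E.gen_eigenvector_deflated_cases[OF V] by blast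
    have "of_real (k * C) * (of_real (rY powr k) * \<nu>) = \<nu>"
      using kC0 by (simp add: rY_rx rxk)
    then have A_u: "gen_eigenvector A (of_real (rY powr k) * \<nu>) m' (?S *v u) \<longleftrightarrow>
        gen_eigenvector Ag \<nu> m' u" for m'
      by (simp only: conj)
    have "V = b *s Lx + (scalar_mat 1 - P) *v (?T *v (?S *v u))"
      unfolding TSx proj by (rule V_eq)
    moreover have "?S *v u \<noteq> 0 \<longrightarrow> u \<noteq> 0" by auto
    ultimately show ?thesis using b u S_span[of u] A_u by metis
  qed
  moreover have "gen_eigenvector A 1 1 (cvec (Lam \<alpha> *v (spow \<alpha> rx *v xs)))"
    using eigA unfolding LY Y0_xs .
  moreover have "eigenvalues_mset A = {#1#} +
      {# of_real (rx powr k) * \<nu>. \<nu> \<in># eigenvalues_mset Dg - {# - of_real C #} #}"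
    unfolding XA XD rxk using kC0 by (simp add: image_mset.compositionality o_def)
  moreover have "let U = ?S *v ((Ag - scalar_mat (of_real (k * C))) *v u)
      in gen_eigenvector A (of_real (rx powr k) * \<nu>) m U \<or>
         \<nu> = of_real (k * C) \<and> U = 0 \<and> gen_eigenvector A 1 1 (?S *v u)"
    if "gen_eigenvector Dg \<nu> m ((scalar_mat 1 - P) *v u)" for \<nu> m u
  proof -
    have "of_real (k * C) * (of_real (rx powr k) * \<nu>) = \<nu>"
      using kC0 by (simp add: rxk)
    then have A_y: "gen_eigenvector A (of_real (rx powr k) * \<nu>) m (?S *v y) \<longleftrightarrow> gen_eigenvector Ag \<nu> m y" for y
      by (simp only: conj)
    have A_one: "gen_eigenvector A 1 1 (?S *v u) \<longleftrightarrow> gen_eigenvector Ag (of_real (k * C)) 1 u"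
      by (simp only: conj mult_1_right)
    have "?S *v 0 = 0" by simp
    then show ?thesis
      using E.gen_eigenvector_shift[OF that[unfolded proj]] unfolding Let_def A_y A_one by metis
  qed
  moreover have "\<exists>u. gen_eigenvector Dg (of_real (rx powr (- k)) * \<mu>) m ((scalar_mat 1 - P) *v u) \<and>
      U = ?S *v ((Ag - scalar_mat (of_real (k * C))) *v u)"
    if "\<mu> \<noteq> 1" "gen_eigenvector A \<mu> m U" for \<mu> m U
  proof -
    have "gen_eigenvector A \<mu> m (?S *v (?T *v U))" using that(2) by (simp add: STx)
    then have "gen_eigenvector Ag (of_real (k * C) * \<mu>) m (?T *v U)" by (simp only: conj)
    moreover have "of_real (k * C) * \<mu> \<noteq> of_real (k * C)" using that(1) kC0 by simp
    ultimately obtain u where "gen_eigenvector Dg (of_real (k * C) * \<mu>) m (E.proj u)"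
      "?T *v U = (Ag - scalar_mat (of_real (k * C))) *v u"
      using E.gen_eigenvector_shift_preimage by blast
    then show ?thesis unfolding proj rxmk by (metis STx)
  qed
  moreover have "\<exists>u. gen_eigenvector Dg (of_real (k * C)) m ((scalar_mat 1 - P) *v u) \<and> U = ?S *v u"
    if "gen_eigenvector A 1 m U" "\<nexists>a. U = a *s LY" for m U
  proof (intro exI conjI)
    have "gen_eigenvector A 1 m (?S *v (?T *v U))" using that(1) by (simp add: STx)
    then have "gen_eigenvector Ag (of_real (k * C)) m (?T *v U)" by (simp only: conj mult_1_right)
    moreover have "\<nexists>b. ?T *v U = b *s Lx" using that(2) S_span[of "?T *v U"] by (simp add: STx)
    ultimately show "gen_eigenvector Dg (of_real (k * C)) m ((scalar_mat 1 - P) *v (?T *v U))"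
      unfolding proj by (rule E.gen_eigenvector_proj)
  qed (simp add: STx)
  moreover have "(1, - of_real C) \<in># mset bD \<and> (\<forall>\<mu>. \<mu> \<noteq> 1 \<longrightarrow> (\<forall>m.
      count (mset bA) (m, \<mu>) =
      count (mset bD - {# (1, - of_real C) #}) (m, of_real (rY powr (- k)) * \<mu>)))"
    if "jordan_nf (jnf_mat A) bA" "jordan_nf (jnf_mat Dg) bD" for bA bD
    unfolding rY_rx rxmk using blocks(2)[OF that(2)] blocks(3)[OF that] by blast
  ultimately show ?thesis using eigA eigD by (intro conjI allI impI) blast+
qed

end
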